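(* Let $\mathbb{K}$ be a field of characteristic zero, let $\overline{\mathcal{A}}$ be an affine $2$-arrangement in $\mathbb{K}^2$, and let $c\overline{\mathcal{A}}$ be its coning with the infinite hyperplane $H_0\in c\overline{\mathcal{A}}$. Let $(\mathcal{A},m)$ be the Ziegler restriction of $c\overline{\mathcal{A}}$ onto $H_0$, and suppose $|\mathcal{A}|=h>2$. If $(\mathcal{A},m)$ is balanced and $$\chi(\overline{\mathcal{A}},t)=(t-d)(t-d-h+2)\quad\text{or}\quad \chi(\overline{\mathcal{A}},t)=(t-d)(t-d-h+3)$$ for some integer $d$, then $c\overline{\mathcal{A}}$ is free.
   Context: An affine $2$-arrangement $\overline{\mathcal{A}}$ is a finite set of affine lines in $\mathbb{K}^2$. Its coning $c\overline{\mathcal{A}}$ is the central arrangement of planes in $\mathbb{K}^3$ (with coordinates $x_1,x_2,z_\infty$) obtained by replacing each line $\{\alpha=k\}$ ($\alpha$ a linear form, $k\in\mathbb{K}$) by the plane $\{\alpha=kz_\infty\}$ and adding the infinite hyperplane $H_0=\{z_\infty=0\}$. The intersection poset $L(\overline{\mathcal{A}})$ consists of the nonempty intersections of subsets of $\overline{\mathcal{A}}$ (including the whole space $V$ as the empty intersection), ordered by reverse inclusion; the Möbius function is $\mu(V)=1$, $\mu(X)=-\sum_{X\subsetneq Y}\mu(Y)$ for $X\ne V$, and $\chi(\overline{\mathcal{A}},t)=\sum_{X\in L(\overline{\mathcal{A}})}\mu(X)t^{\dim X}$. The Ziegler restriction of a central $3$-arrangement $\mathcal{B}$ onto $H_0\in\mathcal{B}$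 is the pair $(\mathcal{B}'',m)$, where $\mathcal{B}''=\{H\cap H_0\mid H\in\mathcal{B}\setminus\{H_0\}\}$, an arrangement of lines in $H_0$, and $m(K)=|\{H\in\mathcal{B}\setminus\{H_0\}\mid H\cap H_0=K\}|$ for $K\in\mathcal{B}''$. A pair $(\mathcal{A},m)$ of a central arrangement of lines in a plane and $m:\mathcal{A}\to\mathbb{Z}_{>0}$ is balanced if $m(K)\le\sum_{H\in\mathcal{A}\setminus\{K\}}m(H)$ for every $K\in\mathcal{A}$. A central arrangement $\mathcal{B}$ in $\mathbb{K}^3$, with defining linear forms $\alpha_H$ ($\ker\alpha_H=H$) and $S$ the polynomial ring in three variables, is free if $D(\mathcal{B})=\{\theta\in\mathrm{Der}(S)\mid\theta(\alpha_H)\in S\alpha_H\ \text{for all } H\in\mathcal{B}\}$ is a free $S$-module, where $\mathrm{Der}(S)$ is the module of $\mathbb{K}$-linear derivations of $S$. *)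

theory Defs
  imports
    "HOL-Analysis.Cartesian_Space"
    "HOL-Computational_Algebra.Polynomial"
    "HOL-Library.Poly_Mapping"
    "HOL-Library.Function_Algebras"
begin

section \<open>Affine 2-arrangements and their characteristic polynomial\<close>

definition affine_line :: "'a::field ^ 2 \<Rightarrow> 'a \<Rightarrow> ('a ^ 2) set" where
  "affine_line a k = {x. scalar_product a x = k}"

definition affine_2_arrangement :: "('a::field ^ 2) set set \<Rightarrow> bool" where
  "affine_2_arrangement A \<longleftrightarrow>
     finite A \<and> (\<forall>L\<in>A. \<exists>a k. a \<noteq> 0 \<and> L = affine_line a k)"

text \<open>The empty subfamily contributes the whole space, since \<open>\<Inter>{} = UNIV\<close>.\<close>

definition intersection_poset :: "'b set set \<Rightarrow> 'b set set" where
  "intersection_poset A = {X. X \<noteq> {} \<and> (\<exists>B\<subseteq>A. X = \<Inter>B)}"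

text \<open>The Moebius function of a finite family \<open>L\<close> of sets ordered by reverse inclusion with
  least element \<open>UNIV\<close>. The value 0 outside \<open>L\<close>, or for infinite \<open>L\<close>, only serves totality.\<close>

function moebius :: "'b set set \<Rightarrow> 'b set \<Rightarrow> int" where
  "moebius L X =
     (if finite L \<and> X \<in> L
      then if X = UNIV then 1 else - (\<Sum>Y\<in>{Y \<in> L. X \<subset> Y}. moebius L Y)
      else 0)"
  by auto
termination
proof (relation "measure (\<lambda>(L, X). card {Y \<in> L. X \<subset> Y})")
  fix L :: "'b set set" and X Y :: "'b set"
  assume fin: "finite L \<and> X \<in> L" and Y: "Y \<in> {Y \<in> L. X \<subset> Y}"
  have "{Z \<in> L. Y \<subset> Z} \<subset> {Z \<in> L. X \<subset> Z}"
    using Y by blast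
  then show "((L, Y), (L, X)) \<in> measure (\<lambda>(L, X). card {Y \<in> L. X \<subset> Y})"
    using fin by (simp add: psubset_card_mono)
qed simp

declare moebius.simps [simp del]

text \<open>For nonempty affine subspaces this is the dimension of the direction space.\<close>

definition affine_dim :: "('a::field ^ 'n) set \<Rightarrow> nat" where
  "affine_dim X = vec.dim {x - y | x y. x \<in> X \<and> y \<in> X}"

definition char_polynomial :: "('a::field ^ 2) set set \<Rightarrow> int poly" where
  "char_polynomial A =
     (\<Sum>X\<in>intersection_poset A. monom (moebius (intersection_poset A) X) (affine_dim X))"

section \<open>Coning\<close>

text \<open>The coordinates \<open>x\<^sub>1, x\<^sub>2, z\<^sub>\<infinity>\<close> of the 3-space are the components 1, 2, 3.\<close>

definition cone_plane :: "'a::field ^ 2 \<Rightarrow> 'a \<Rightarrow> ('a ^ 3) set" where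
  "cone_plane a k = {x. a $ 1 * x $ 1 + a $ 2 * x $ 2 = k * x $ 3}"

definition infinite_hyperplane :: "('a::field ^ 3) set" where
  "infinite_hyperplane = {x. x $ 3 = 0}"

text \<open>Equations of the same line differ by a nonzero factor, so they all give the same plane.\<close>

definition coning :: "('a::field ^ 2) set set \<Rightarrow> ('a ^ 3) set set" where
  "coning A = insert infinite_hyperplane
     {cone_plane a k | a k. a \<noteq> 0 \<and> affine_line a k \<in> A}"

section \<open>Ziegler restriction and balancedness\<close>

definition ziegler_arrangement :: "'b set set \<Rightarrow> 'b set \<Rightarrow> 'b set set" where
  "ziegler_arrangement B H0 = (\<lambda>H. H \<inter> H0) ` (B - {H0})"

definition ziegler_mult :: "'b set set \<Rightarrow> 'b set \<Rightarrow> 'b set \<Rightarrow> nat" where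
  "ziegler_mult B H0 K = card {H \<in> B - {H0}. H \<inter> H0 = K}"

definition ziegler_restriction :: "'b set set \<Rightarrow> 'b set \<Rightarrow> 'b set set \<times> ('b set \<Rightarrow> nat)" where
  "ziegler_restriction B H0 = (ziegler_arrangement B H0, ziegler_mult B H0)"

definition balanced :: "'b set set \<Rightarrow> ('b set \<Rightarrow> nat) \<Rightarrow> bool" where
  "balanced A m \<longleftrightarrow> (\<forall>K\<in>A. m K \<le> (\<Sum>H\<in>A - {K}. m H))"

section \<open>Logarithmic derivations and freeness\<close>

text \<open>Polynomials in three variables: the exponents are the finitely supported maps
  \<open>3 \<Rightarrow>\<^sub>0 nat\<close>, and the product on \<open>\<Rightarrow>\<^sub>0\<close> is convolution.\<close>

type_synonym 'a poly3 = "(3 \<Rightarrow>\<^sub>0 nat) \<Rightarrow>\<^sub>0 'a"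

definition const3 :: "'a::field \<Rightarrow> 'a poly3" where
  "const3 c = Poly_Mapping.single 0 c"

definition var3 :: "3 \<Rightarrow> 'a::field poly3" where
  "var3 i = Poly_Mapping.single (Poly_Mapping.single i 1) 1"

definition linear_form :: "'a::field ^ 3 \<Rightarrow> 'a poly3" where
  "linear_form a = (\<Sum>i\<in>UNIV. const3 (a $ i) * var3 i)"

definition derivation3 :: "('a::field poly3 \<Rightarrow> 'a poly3) \<Rightarrow> bool" where
  "derivation3 \<theta> \<longleftrightarrow>
     (\<forall>f g. \<theta> (f + g) = \<theta> f + \<theta> g) \<and>
     (\<forall>c f. \<theta> (const3 c * f) = const3 c * \<theta> f) \<and>
     (\<forall>f g. \<theta> (f * g) = f * \<theta> g + g * \<theta> f)"

text \<open>Linear forms with the same kernel differ by a nonzero scalar, so quantifying over all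
  defining forms of a plane amounts to choosing one.\<close>

definition log_derivations :: "('a::field ^ 3) set set \<Rightarrow> ('a poly3 \<Rightarrow> 'a poly3) set" where
  "log_derivations B =
     {\<theta>. derivation3 \<theta> \<and>
        (\<forall>a. a \<noteq> 0 \<and> {x. scalar_product a x = 0} \<in> B \<longrightarrow> linear_form a dvd \<theta> (linear_form a))}"

definition der_scale :: "'a::field poly3 \<Rightarrow> ('a poly3 \<Rightarrow> 'a poly3) \<Rightarrow> ('a poly3 \<Rightarrow> 'a poly3)" where
  "der_scale s \<theta> = (\<lambda>f. s * \<theta> f)"

interpretation der: module der_scale
  by unfold_locales (auto simp: der_scale_def fun_eq_iff algebra_simps)

definition free_arrangement :: "('a::field ^ 3) set set \<Rightarrow> bool" where
  "free_arrangement B \<longleftrightarrow>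
     (\<exists>E. E \<subseteq> log_derivations B \<and> der.independent E \<and> der.span E = log_derivations B)"

end

theory Submission
  imports Defs
begin

text \<open>
  Let \<open>n\<close> be the number of lines and \<open>b\<close> the constant term of the characteristic polynomial. After a
  shear every line reads \<open>x = t * y + c\<close>, and homogenization identifies logarithmic derivations of the
  cone killing \<open>z\<close> with polynomial vector fields \<open>(f, g)\<close> tangent to all lines. The leading part of such a
  field, dehomogenized to one variable, is a logarithmic derivation of the Ziegler restriction.

  Let \<open>e\<close> be the least degree of a nonzero derivation of the Ziegler restriction. Counting dimensions gives
  \<open>2 * e \<le> n\<close>, and the Wronskian of its two components gives \<open>n - h + 2 \<le> 2 * e\<close>; here
  characteristic zero and balancedness enter. Both forms of the characteristic polynomial then yield
  \<open>b \<le> e * (n - e)\<close>.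

  Adding the lines one at a time bounds the dimension of the tangent fields of bounded degree from below in
  terms of \<open>n\<close> and \<open>b\<close>. The derivations of the Ziegler restriction bound the space of leading parts from
  above. For \<open>b \<le> e * (n - e)\<close> the two bounds meet, so there are tangent fields of degrees \<open>e\<close> and
  \<open>n - e\<close> with independent leading parts. Their determinant has degree \<open>n\<close> and vanishes on every line, so
  it is the product of the equations of the lines up to a constant, and Saito's criterion applies.
\<close>

section \<open>Linear algebra\<close>

text \<open>A free module with exponents \<open>e\<close> and \<open>n - e\<close> has dimension
  max(0, k + 1 - e) + max(0, k + 1 + e - n) in degree k; this is the upper bound used for the
  leading parts. It rests on a single derivation of least degree, and no second generator of the
  Ziegler restriction is constructed. Summed over the degrees up to \<open>n\<close>, upper bound
  minus lower bound is \<open>b - e * (n - e)\<close>. So \<open>b <= e * (n - e)\<close> forces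
  equality in every single degree.

  For both polynomials b = d * (n - d), with n = 2 * d + h - 2 or n = 2 * d + h - 3. The Wronskian
  bound reads 2 * e >= 2 * d in the first case and 2 * e >= 2 * d - 1 in the second; parity gives e
  >= d in both, which is why the offset 3 is still admissible. From d <= e <= n / 2 follows d * (n -
  d) <= e * (n - e).

  Characteristic zero has a second use: the field is infinite, so some shear leaves no line of the
  form y = const.\<close>

context vector_space_pair
begin

text \<open>The polynomial spaces below are infinite dimensional, so finiteness is asked only of a
  set spanning \<open>V\<close>. A basis \<open>B0\<close> of the kernel in \<open>V\<close> is
  extended to a basis of \<open>V\<close>, and \<open>f\<close> carries the added vectors
  \<open>C\<close> to a basis of the image.\<close>

lemma rank_nullity:
  assumes f: "Vector_Spaces.linear s1 s2 f"
    and V: "vs1.subspace V" and fin: "finite B" "V \<subseteq> vs1.span B"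
  shows "vs1.dim V = vs1.dim {v \<in> V. f v = 0} + vs2.dim (f ` V)"
proof -
  interpret f: Vector_Spaces.linear s1 s2 f by (rule f)
  let ?N = "{v \<in> V. f v = 0}"
  obtain B0 where B0: "B0 \<subseteq> ?N" "vs1.independent B0" "?N \<subseteq> vs1.span B0"
    using vs1.maximal_independent_subset by blast
  obtain B1 where B1: "B0 \<subseteq> B1" "B1 \<subseteq> V" "vs1.independent B1" "V \<subseteq> vs1.span B1"
    using vs1.maximal_independent_subset_extend[of B0 V] B0 by blast
  have finB1: "finite B1"
    using vs1.independent_span_bound[OF fin(1) B1(3)] B1(2) fin(2) by blast
  define C where "C = B1 - B0"
  have spC: "vs1.span C \<subseteq> V"
    by (rule vs1.span_minimal) (use B1 V C_def in auto)
  have indC: "vs1.independent C"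
    using B1(3) vs1.independent_mono unfolding C_def by blast
  \<comment> \<open>A vector in the spans of both \<open>B0\<close> and \<open>C\<close> has
    coordinates with respect to \<open>B1\<close> supported in both sets, hence all zero.\<close>
  have zero: "x = 0" if x: "x \<in> vs1.span C" "f x = 0" for x
  proof -
    have "x \<in> vs1.span B0" using x spC B0(3) by blast
    have "vs1.representation B1 x = vs1.representation B0 x"
      "vs1.representation B1 x = vs1.representation C x"
      using vs1.representation_extend[OF B1(3) \<open>x \<in> vs1.span B0\<close> B1(1)]
        vs1.representation_extend[OF B1(3) x(1)] C_def by auto
    then have "vs1.representation B1 x b = 0" for b
      by (metis C_def DiffD2 vs1.representation_ne_zero)
    then show ?thesis
      using vs1.sum_nonzero_representation_eq[OF B1(3), of x] x(1) spC B1(4) by auto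
  qed
  have inj: "inj_on f (vs1.span C)"
  proof (rule inj_onI)
    fix x y assume "x \<in> vs1.span C" "y \<in> vs1.span C" "f x = f y"
    then have "x - y = 0"
      by (intro zero) (auto simp: f.diff vs1.span_diff)
    then show "x = y" by simp
  qed
  have ind: "vs2.independent (f ` C)"
    using f.independent_injective_image[OF indC inj] .
  have "f ` V \<subseteq> vs2.span (f ` C)"
  proof safe
    fix v assume "v \<in> V"
    then have "v \<in> vs1.span (B0 \<union> C)" using B1 unfolding C_def by (metis Un_Diff_cancel Un_absorb1 subsetD)
    then obtain a b where ab: "v = a + b" "a \<in> vs1.span B0" "b \<in> vs1.span C"
      unfolding vs1.span_Un by blast
    have "vs1.span B0 \<subseteq> ?N"
      by (rule vs1.span_minimal[OF B0(1)])
         (use V in \<open>auto simp: vs1.subspace_def f.add f.scale f.zero\<close>)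
    then have "f v = f b" using ab by (auto simp: f.add)
    then show "f v \<in> vs2.span (f ` C)" using ab(3) f.span_image by auto
  qed
  moreover have "f ` C \<subseteq> f ` V" using B1 C_def by auto
  ultimately have "vs2.dim (f ` V) = card (f ` C)"
    using vs2.basis_card_eq_dim[OF _ _ ind] by simp
  also have "\<dots> = card C"
    by (meson card_image inj inj_on_subset vs1.span_superset)
  finally have *: "vs2.dim (f ` V) = card C" .
  have "vs1.dim ?N = card B0" "vs1.dim V = card B1"
    using vs1.basis_card_eq_dim[OF B0(1,3,2)] vs1.basis_card_eq_dim[OF B1(2,4,3)] by simp_all
  moreover have "card B1 = card B0 + card C"
    using finB1 B1(1) unfolding C_def by (metis card_Un_disjoint Diff_disjoint Un_Diff_cancel Un_absorb1 finite_Un)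
  ultimately show ?thesis using * by simp
qed

end

context vector_space
begin

lemma dim_pos_imp_nonzero:
  assumes "dim S > 0" obtains x where "x \<in> S" "x \<noteq> 0"
proof -
  have "dim S \<le> card ({}::'b set)" if "S \<subseteq> {0}"
    by (rule dim_le_card) (use that in auto)
  then show ?thesis using that assms by auto
qed

end

section \<open>Multiarrangements of lines through the origin\<close>

interpretation upoly: vector_space "smult :: 'a::field \<Rightarrow> 'a poly \<Rightarrow> 'a poly"
  by unfold_locales (auto simp: smult_add_left smult_add_right)

definition scale2 :: "'a::field \<Rightarrow> 'a poly \<times> 'a poly \<Rightarrow> 'a poly \<times> 'a poly" where
  "scale2 c x = (smult c (fst x), smult c (snd x))"

interpretation upair: vector_space "scale2 :: 'a::field \<Rightarrow> _"
  by unfold_locales (auto simp: scale2_def smult_add_left smult_add_right)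

interpretation upoly_self: vector_space_pair "smult :: 'a::field \<Rightarrow> 'a poly \<Rightarrow> 'a poly" "(*) :: 'a \<Rightarrow> 'a \<Rightarrow> 'a"
  by unfold_locales

interpretation upair_upoly: vector_space_pair "scale2 :: 'a::field \<Rightarrow> _" "smult :: 'a \<Rightarrow> 'a poly \<Rightarrow> 'a poly"
  by unfold_locales

lemma dim_self: "vector_space_over_itself.dim (UNIV :: 'a::field set) = 1"
proof -
  have "vector_space_over_itself.span {1::'a} = UNIV"
    using vector_space_over_itself.span_base[of "1::'a" "{1}"] vector_space_over_itself.span_scale[of "1::'a" "{1}"] by fastforce
  then show ?thesis
    using vector_space_over_itself.basis_card_eq_dim[of "{1::'a}" UNIV] by simp
qed

text \<open>Phrased by coefficients because \<open>degree 0 = 0\<close>: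
  \<open>coeffs_below 0\<close> is then the zero space, and truncated differences
  \<open>k - j\<close> give the right dimensions.\<close>

definition coeffs_below :: "nat \<Rightarrow> 'a::zero poly set" where
  "coeffs_below k = {p. \<forall>i\<ge>k. coeff p i = 0}"

lemma coeffs_below_iff: "p \<in> coeffs_below k \<longleftrightarrow> p = 0 \<or> degree p < k"
proof
  assume p: "p \<in> coeffs_below k"
  show "p = 0 \<or> degree p < k"
  proof (rule ccontr)
    assume "\<not> (p = 0 \<or> degree p < k)"
    then have "p \<noteq> 0" "k \<le> degree p" by auto
    with p show False by (auto simp: coeffs_below_def)
  qed
qed (auto simp: coeffs_below_def coeff_eq_0)

lemma coeffs_below_Suc: "p \<in> coeffs_below (Suc k) \<longleftrightarrow> degree p \<le> k"
  by (auto simp: coeffs_below_iff)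

lemma coeffs_below_0 [simp]: "coeffs_below 0 = {0}"
  by (auto simp: coeffs_below_iff)

lemma subspace_coeffs_below: "upoly.subspace (coeffs_below k)"
  by (auto simp: upoly.subspace_def coeffs_below_def)

lemma coeffs_below_eq_sum:
  fixes p :: "'a::field poly"
  assumes "p \<in> coeffs_below k"
  shows "(\<Sum>i<k. monom (coeff p i) i) = p"
proof (cases k)
  case 0
  then show ?thesis using assms by simp
next
  case (Suc j)
  then have "degree p \<le> j" using assms by (simp add: coeffs_below_Suc)
  then have "(\<Sum>i\<le>j. monom (coeff p i) i) = p" by (rule poly_as_sum_of_monoms')
  then show ?thesis using Suc by (simp add: smult_monom lessThan_Suc_atMost)
qed

lemma coeffs_below_span: "coeffs_below k \<subseteq> upoly.span (monom (1::'a::field) ` {..<k})"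
proof
  fix p :: "'a poly" assume "p \<in> coeffs_below k"
  then have "p = (\<Sum>i<k. smult (coeff p i) (monom 1 i))"
    by (simp add: smult_monom coeffs_below_eq_sum)
  also have "\<dots> \<in> upoly.span (monom 1 ` {..<k})"
    by (intro upoly.span_sum upoly.span_scale upoly.span_base) auto
  finally show "p \<in> upoly.span (monom 1 ` {..<k})" .
qed

lemma dim_coeffs_below: "upoly.dim (coeffs_below k :: 'a::field poly set) = k"
proof (induction k)
  case 0
  have "upoly.dim {0::'a poly} \<le> card ({}::'a poly set)"
    by (rule upoly.dim_le_card) auto
  then show ?case by simp
next
  case (Suc k)
  have lin: "Vector_Spaces.linear smult (*) (\<lambda>p::'a poly. coeff p k)"
    by unfold_locales auto
  have "{v \<in> coeffs_below (Suc k). coeff v k = 0} = (coeffs_below k :: 'a poly set)"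
    by (auto simp: coeffs_below_def Suc_le_eq nat_less_le)
  moreover have "(\<lambda>p. coeff p k) ` coeffs_below (Suc k) = (UNIV :: 'a set)"
  proof -
    have "c \<in> (\<lambda>p. coeff p k) ` coeffs_below (Suc k)" for c :: 'a
      by (rule image_eqI[of _ _ "monom c k"]) (auto simp: coeffs_below_def)
    then show ?thesis by auto
  qed
  ultimately show ?case
    using upoly_self.rank_nullity[OF lin subspace_coeffs_below _ coeffs_below_span, of "Suc k"] Suc dim_self
    by simp
qed

text \<open>Converts divisibility by a known \<open>w\<close> into a dimension bound for the images
  that occur in \<open>rank_nullity\<close>.\<close>

lemma dim_le_if_subset_multiples:
  fixes w :: "'a::field poly"
  assumes "V \<subseteq> (\<lambda>s. w * s) ` coeffs_below k"
  shows "upoly.dim V \<le> k"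
proof -
  have "(\<lambda>s. w * s) ` coeffs_below k \<subseteq> upoly.span ((\<lambda>i. w * monom 1 i) ` {..<k})"
  proof safe
    fix s :: "'a poly" assume "s \<in> coeffs_below k"
    then have "w * s = w * (\<Sum>i<k. smult (coeff s i) (monom 1 i))"
      by (simp add: smult_monom coeffs_below_eq_sum)
    also have "\<dots> = (\<Sum>i<k. smult (coeff s i) (w * monom 1 i))"
      by (simp only: sum_distrib_left mult_smult_right)
    also have "\<dots> \<in> upoly.span ((\<lambda>i. w * monom 1 i) ` {..<k})"
      by (intro upoly.span_sum upoly.span_scale upoly.span_base) auto
    finally show "w * s \<in> upoly.span ((\<lambda>i. w * monom 1 i) ` {..<k})" .
  qed
  with assms have "V \<subseteq> upoly.span ((\<lambda>i. w * monom 1 i) ` {..<k})" by (rule order_trans)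
  from upoly.dim_le_card[OF this] show ?thesis
    using card_image_le[of "{..<k}" "\<lambda>i. w * monom 1 i"] by simp
qed

lemma pair_span:
  "coeffs_below k \<times> coeffs_below k \<subseteq> upair.span ((\<lambda>i. (monom 1 i, 0)) ` {..<k} \<union> (\<lambda>i. (0, monom (1::'a::field) i)) ` {..<k})"
    (is "_ \<subseteq> upair.span ?B")
proof safe
  fix p q :: "'a poly" assume p: "p \<in> coeffs_below k" and q: "q \<in> coeffs_below k"
  have "(p, q) = (\<Sum>i<k. scale2 (coeff p i) (monom 1 i, 0)) + (\<Sum>i<k. scale2 (coeff q i) (0, monom 1 i))"
    using coeffs_below_eq_sum[OF p] coeffs_below_eq_sum[OF q]
    by (simp add: scale2_def prod_eq_iff fst_sum snd_sum smult_monom)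
  also have "\<dots> \<in> upair.span ?B"
    by (intro upair.span_add upair.span_sum upair.span_scale upair.span_base) auto
  finally show "(p, q) \<in> upair.span ?B" .
qed

lemma dim_pairs: "upair.dim (coeffs_below k \<times> coeffs_below k :: ('a::field poly \<times> 'a poly) set) = 2 * k"
proof -
  let ?V = "coeffs_below k \<times> coeffs_below k :: ('a poly \<times> 'a poly) set"
  have lin: "Vector_Spaces.linear scale2 smult (fst :: 'a poly \<times> 'a poly \<Rightarrow> _)"
    "Vector_Spaces.linear scale2 smult (snd :: 'a poly \<times> 'a poly \<Rightarrow> _)"
    by unfold_locales (auto simp: scale2_def)
  have z: "0 \<in> (coeffs_below k :: 'a poly set)" by (simp add: coeffs_below_def)
  then have "0 \<in> ?V" by (simp add: mem_Times_iff del: mem_Sigma_iff)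
  then have sub: "upair.subspace ?V" "upair.subspace {v \<in> ?V. fst v = 0}"
    using subspace_coeffs_below[where 'a='a]
    by (auto simp: upair.subspace_def upoly.subspace_def scale2_def simp del: mem_Sigma_iff)
  have 1: "upair.dim ?V = upair.dim {v \<in> ?V. fst v = 0} + upoly.dim (fst ` ?V)"
    by (rule upair_upoly.rank_nullity[OF lin(1) sub(1) _ pair_span]) auto
  have 2: "upair.dim {v \<in> ?V. fst v = 0} =
      upair.dim {v \<in> {v \<in> ?V. fst v = 0}. snd v = 0} + upoly.dim (snd ` {v \<in> ?V. fst v = 0})"
    by (rule upair_upoly.rank_nullity[OF lin(2) sub(2) _ order_trans[OF _ pair_span]]) auto
  have "snd ` {v \<in> ?V. fst v = 0} = coeffs_below k" using z by force
  moreover have "{v \<in> {v \<in> ?V. fst v = 0}. snd v = 0} = {0}" using z by (auto simp: prod_eq_iff)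
  moreover have "upair.dim {0 :: 'a poly \<times> 'a poly} = 0"
    using upair.dim_le_card[of "{0}" "{}"] by simp
  moreover have "fst ` ?V = coeffs_below k" using z by force
  ultimately show ?thesis using 1 2 by (simp add: dim_coeffs_below)
qed

text \<open>Distinct roots give coprime factors: the product over the other roots has order 0 at
  \<open>t\<close>, so the order of \<open>P\<close> at \<open>t\<close> is carried by the cofactor
  \<open>R\<close>. Orders are meaningful only for nonzero \<open>P\<close>, hence the case
  split.\<close>

lemma prod_linear_powers_dvd:
  fixes P :: "'a::field poly"
  assumes "finite S" "\<And>t. t \<in> S \<Longrightarrow> [:- t, 1:] ^ m t dvd P"
  shows "(\<Prod>t\<in>S. [:- t, 1:] ^ m t) dvd P"
  using assms
proof (induction S rule: finite_induct)
  case (insert t S)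
  then obtain R where R: "P = (\<Prod>t\<in>S. [:- t, 1:] ^ m t) * R" by (auto elim: dvdE)
  have "[:- t, 1:] ^ m t dvd R"
  proof (cases "P = 0")
    case False
    have "poly (\<Prod>t\<in>S. [:- t, 1:] ^ m t) t \<noteq> 0"
      using insert.hyps by (auto simp: poly_prod poly_power)
    then have "order t (\<Prod>t\<in>S. [:- t, 1:] ^ m t) = 0" by (rule order_0I)
    moreover have "m t \<le> order t P" using insert.prems[of t] False by (auto simp: order_divides)
    ultimately show ?thesis using R False by (auto simp: order_divides order_mult)
  next
    case True
    moreover have "(\<Prod>t\<in>S. [:- t, 1:] ^ m t) \<noteq> 0" using insert.hyps by auto
    ultimately show ?thesis using R by simp
  qed
  then show ?case using insert.hyps R by (simp add: mult_dvd_mono mult.commute)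
qed simp

lemma degree_prod_linear_powers:
  "degree (\<Prod>t\<in>S. [:- t, 1:: 'a::field:] ^ m t) = (\<Sum>t\<in>S. m t)"
  by (subst degree_prod_eq_sum_degree) (auto simp: degree_power_eq)

lemma dvd_coeffs_below:
  fixes P :: "'a::field poly"
  assumes "P \<in> coeffs_below k" "Q dvd P" "Q \<noteq> 0"
  shows "P \<in> (\<lambda>s. Q * s) ` coeffs_below (k - degree Q)"
proof -
  obtain s where s: "P = Q * s" using assms(2) by auto
  have "s \<in> coeffs_below (k - degree Q)"
    using assms(1,3) by (cases "s = 0") (auto simp: s coeffs_below_iff degree_mult_eq)
  then show ?thesis using s by auto
qed

lemma coeff_mult_top:
  assumes "degree p \<le> k" "degree q \<le> l"
  shows "coeff (p * q) (k + l) = coeff p k * coeff q l"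
proof (cases "degree p = k \<and> degree q = l")
  case True
  then show ?thesis using coeff_mult_degree_sum by blast
next
  case False
  then have "degree p + degree q < k + l" using assms by linarith
  then have "coeff (p * q) (k + l) = 0"
    using degree_mult_le[of p q] by (intro coeff_eq_0) linarith
  then show ?thesis using False assms by (auto simp: coeff_eq_0)
qed

text \<open>A homogeneous plane derivation of degree \<open>k\<close>, written with the second
  variable y set to 1; hence degree at most \<open>k\<close> rather than exactly \<open>k\<close>.
  The condition at \<open>t\<close> says that (x - t * y) ^ m t divides its value at x - t * y. The
  line y = 0 is never among these lines, so setting y to 1 loses nothing.\<close>

definition log_pairs :: "'a::field set \<Rightarrow> ('a \<Rightarrow> nat) \<Rightarrow> nat \<Rightarrow> ('a poly \<times> 'a poly) set" where
  "log_pairs S m k = {x \<in> coeffs_below (Suc k) \<times> coeffs_below (Suc k).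
     \<forall>t\<in>S. [:- t, 1:] ^ m t dvd fst x - smult t (snd x)}"

lemma subspace_log_pairs: "upair.subspace (log_pairs S m k)"
proof -
  have "[:- t, 1:] ^ m t dvd smult c p - smult t (smult c q)"
    if "[:- t, 1:] ^ m t dvd p - smult t q" for c t and p q :: "'a poly"
    using dvd_smult[OF that, of c] by (simp add: smult_diff_right mult.commute)
  moreover have "[:- t, 1:] ^ m t dvd (p + p') - smult t (q + q')"
    if "[:- t, 1:] ^ m t dvd p - smult t q" "[:- t, 1:] ^ m t dvd p' - smult t q'" for t and p q p' q' :: "'a poly"
    using dvd_add[OF that] by (simp add: smult_add_right algebra_simps)
  ultimately show ?thesis
    using subspace_coeffs_below[where 'a='a]
    by (auto simp: upair.subspace_def upoly.subspace_def log_pairs_def scale2_def mem_Times_iff)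
qed

lemma log_pairs_span:
  "log_pairs S m k \<subseteq> upair.span ((\<lambda>i. (monom 1 i, 0)) ` {..<Suc k} \<union> (\<lambda>i. (0, monom 1 i)) ` {..<Suc k})"
  using pair_span[of "Suc k"] by (auto simp: log_pairs_def)

text \<open>The condition at \<open>t\<close> is the vanishing of a remainder modulo a polynomial of
  degree \<open>m t\<close>, so each \<open>t\<close> costs at most \<open>m t\<close> of the
  \<open>2 * Suc k\<close> dimensions.\<close>

lemma dim_log_pairs_ge:
  assumes "finite S"
  shows "2 * Suc k \<le> upair.dim (log_pairs S m k) + (\<Sum>t\<in>S. m t)"
  using assms
proof (induction S rule: finite_induct)
  case empty
  show ?case using dim_pairs[of "Suc k", where 'a='a] by (simp add: log_pairs_def)
next
  case (insert t S)
  let ?b = "[:- t, 1:] ^ m t"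
  let ?f = "\<lambda>x. (fst x - smult t (snd x)) mod ?b"
  have lin: "Vector_Spaces.linear scale2 smult ?f"
    by unfold_locales
      (auto simp: scale2_def poly_mod_add_left poly_mod_diff_left mod_smult_left smult_add_right smult_diff_right
        algebra_simps mult.commute)
  have "?f ` log_pairs S m k \<subseteq> upoly.span (monom 1 ` {..<m t})"
  proof -
    have "?f x \<in> coeffs_below (m t)" for x
    proof -
      have "degree ?b = m t" by (simp add: degree_power_eq)
      then show ?thesis using degree_mod_less[of ?b "fst x - smult t (snd x)"] by (auto simp: coeffs_below_iff)
    qed
    then show ?thesis using coeffs_below_span by blast
  qed
  from upoly.dim_le_card[OF this] have "upoly.dim (?f ` log_pairs S m k) \<le> m t"
    using card_image_le[of "{..<m t}" "monom (1::'a)"] by simp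
  moreover have "{x \<in> log_pairs S m k. ?f x = 0} = log_pairs (insert t S) m k"
    by (auto simp: log_pairs_def mod_eq_0_iff_dvd)
  moreover have "upair.dim (log_pairs S m k) = upair.dim {x \<in> log_pairs S m k. ?f x = 0} + upoly.dim (?f ` log_pairs S m k)"
    by (rule upair_upoly.rank_nullity[OF lin subspace_log_pairs _ log_pairs_span]) auto
  ultimately show ?case using insert by simp
qed

text \<open>Saito's determinant of two plane derivations, used for leading parts in one variable and
  for fields in two.\<close>

definition pair_det :: "'a::comm_ring_1 \<times> 'a \<Rightarrow> 'a \<times> 'a \<Rightarrow> 'a" where
  "pair_det x y = fst x * snd y - snd x * fst y"

text \<open>\<open>e\<close> is the smaller exponent of the multiarrangement given by
  \<open>S\<close> and \<open>m\<close>, and \<open>y\<close> realizes it.\<close>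

locale minimal_log_pair =
  fixes S :: "'a::field set" and m :: "'a \<Rightarrow> nat" and e :: nat and y :: "'a poly \<times> 'a poly"
  assumes finite_S: "finite S"
    and y_in: "y \<in> log_pairs S m e" and y_nz: "y \<noteq> 0"
    and minimal: "\<And>k x. x \<in> log_pairs S m k \<Longrightarrow> x \<noteq> 0 \<Longrightarrow> e \<le> k"
begin

lemma y_degree: "degree (fst y) \<le> e" "degree (snd y) \<le> e"
  using y_in by (auto simp: log_pairs_def coeffs_below_Suc)

text \<open>Otherwise the homogeneous form of \<open>y\<close> would be divisible by the second
  variable, and the quotient would be a derivation of smaller degree; for \<open>e = 0\<close> it
  would be zero.\<close>

lemma lead_nz: "coeff (fst y) e \<noteq> 0 \<or> coeff (snd y) e \<noteq> 0"
proof (rule ccontr)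
  assume "\<not> ?thesis"
  then have z: "coeff (fst y) e = 0" "coeff (snd y) e = 0" by auto
  have "p \<in> coeffs_below e" if "p \<in> coeffs_below (Suc e)" "coeff p e = 0" for p :: "'a poly"
    using that by (auto simp: coeffs_below_def Suc_le_eq nat_less_le)
  then have "y \<in> coeffs_below e \<times> coeffs_below e"
    using y_in z by (simp add: log_pairs_def mem_Times_iff)
  then show False
  proof (cases e)
    case 0
    then show False using \<open>y \<in> _\<close> y_nz by (auto simp: prod_eq_iff)
  next
    case (Suc j)
    then have "y \<in> log_pairs S m j" using \<open>y \<in> _\<close> y_in by (auto simp: log_pairs_def)
    then show False using minimal[OF _ y_nz] Suc by fastforce
  qed
qed

text \<open>A priori \<open>x\<close> is only a rational multiple of \<open>y\<close>. Long division
  by \<open>y\<close> lowers the degree, and a remainder of degree below \<open>e\<close> is 0 by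
  minimality, so the multiplier is a polynomial.\<close>

lemma parallel_multiple:
  assumes "x \<in> log_pairs S m k" "pair_det x y = 0"
  shows "\<exists>u\<in>coeffs_below (Suc k - e). x = (u * fst y, u * snd y)"
  using assms
proof (induction k arbitrary: x rule: less_induct)
  case (less k)
  show ?case
  proof (cases "x = 0")
    case True
    then show ?thesis by (intro bexI[of _ 0]) (auto simp: coeffs_below_def prod_eq_iff)
  next
    case False
    then have ke: "e \<le> k" using minimal less.prems by blast
    have dx: "degree (fst x) \<le> k" "degree (snd x) \<le> k"
      using less.prems by (auto simp: log_pairs_def coeffs_below_Suc)
    have "coeff (fst x * snd y) (k + e) = coeff (snd x * fst y) (k + e)"
      using less.prems(2) by (simp add: pair_det_def)
    \<comment> \<open>Vanishing of the determinant in degree \<open>k + e\<close> makes the leading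
      vectors of \<open>x\<close> and \<open>y\<close> parallel; by \<open>lead_nz\<close> the one
      of \<open>y\<close> is not zero.\<close>
    then have top: "coeff (fst x) k * coeff (snd y) e = coeff (snd x) k * coeff (fst y) e"
      using coeff_mult_top[OF dx(1) y_degree(2)] coeff_mult_top[OF dx(2) y_degree(1)] by simp
    obtain c where c: "coeff (fst x) k = c * coeff (fst y) e" "coeff (snd x) k = c * coeff (snd y) e"
    proof (cases "coeff (fst y) e = 0")
      case True
      then show thesis using that[of "coeff (snd x) k / coeff (snd y) e"] top lead_nz by (auto simp: field_simps)
    next
      case False
      then show thesis using that[of "coeff (fst x) k / coeff (fst y) e"] top by (auto simp: field_simps)
    qed
    define w where "w = monom c (k - e)"
    define x' where "x' = (fst x - w * fst y, snd x - w * snd y)"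
    have cw: "coeff (w * p) i = (if i < k - e then 0 else c * coeff p (i - (k - e)))" for p i
      by (simp add: w_def coeff_monom_mult)
    have x'_below: "fst x' \<in> coeffs_below k" "snd x' \<in> coeffs_below k"
    proof -
      have top_zero: "coeff p i - (if i < k - e then 0 else c * coeff q (i - (k - e))) = 0"
        if "degree p \<le> k" "degree q \<le> e" "coeff p k = c * coeff q e" "k \<le> i" for p q :: "'a poly" and i
      proof (cases "i = k")
        case True
        then show ?thesis using that ke by auto
      next
        case False
        then have "coeff p i = 0" "coeff q (i - (k - e)) = 0" using that ke by (auto intro!: coeff_eq_0)
        then show ?thesis by simp
      qed
      show "fst x' \<in> coeffs_below k" "snd x' \<in> coeffs_below k"
        using top_zero[OF dx(1) y_degree(1) c(1)] top_zero[OF dx(2) y_degree(2) c(2)]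
        by (simp_all add: coeffs_below_def x'_def cw)
    qed
    have x'_dvd: "[:- t, 1:] ^ m t dvd fst x' - smult t (snd x')" if "t \<in> S" for t
    proof -
      have "[:- t, 1:] ^ m t dvd (fst x - smult t (snd x)) - w * (fst y - smult t (snd y))"
        by (rule dvd_diff[OF _ dvd_mult]) (use that less.prems(1) y_in in \<open>auto simp: log_pairs_def\<close>)
      also have "\<dots> = fst x' - smult t (snd x')"
        by (simp add: x'_def algebra_simps smult_diff_right)
      finally show ?thesis .
    qed
    have x'_det: "pair_det x' y = 0"
      using less.prems(2) by (simp add: pair_det_def x'_def algebra_simps)
    have "\<exists>u\<in>coeffs_below (k - e). x' = (u * fst y, u * snd y)"
    proof (cases k)
      case 0
      then have "x' = 0" using x'_below by (auto simp: prod_eq_iff)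
      then show ?thesis by (intro bexI[of _ 0]) (auto simp: coeffs_below_def prod_eq_iff)
    next
      case (Suc j)
      then have "x' \<in> log_pairs S m j" using x'_below x'_dvd by (simp add: log_pairs_def mem_Times_iff)
      from less.IH[OF _ this x'_det] Suc show ?thesis by simp
    qed
    then obtain u where u: "u \<in> coeffs_below (k - e)" "x' = (u * fst y, u * snd y)" by auto
    have "x = ((u + w) * fst y, (u + w) * snd y)"
      using u(2) by (auto simp: x'_def prod_eq_iff algebra_simps)
    moreover have "u + w \<in> coeffs_below (Suc k - e)"
      using u(1) ke by (auto simp: coeffs_below_def w_def coeff_monom Suc_diff_le)
    ultimately show ?thesis by blast
  qed
qed

lemma linear_det: "Vector_Spaces.linear scale2 smult (\<lambda>x. pair_det x y)"
  by unfold_locales (auto simp: pair_det_def scale2_def algebra_simps smult_diff_right)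

lemma dim_parallel_le:
  assumes "W \<subseteq> log_pairs S m k"
  shows "upair.dim {x \<in> W. pair_det x y = 0} \<le> Suc k - e"
proof -
  let ?B = "(\<lambda>i. (monom 1 i * fst y, monom 1 i * snd y)) ` {..<Suc k - e}"
  have "{x \<in> W. pair_det x y = 0} \<subseteq> upair.span ?B"
  proof safe
    fix p q assume x: "(p, q) \<in> W" "pair_det (p, q) y = 0"
    then have "(p, q) \<in> log_pairs S m k" using assms by auto
    from parallel_multiple[OF this x(2)] obtain u
      where u: "u \<in> coeffs_below (Suc k - e)" "p = u * fst y" "q = u * snd y" by auto
    have "u * v = (\<Sum>i<Suc k - e. smult (coeff u i) (monom 1 i * v))" for v
    proof -
      have "u * v = (\<Sum>i<Suc k - e. monom (coeff u i) i) * v"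
        by (simp only: coeffs_below_eq_sum[OF u(1)])
      also have "\<dots> = (\<Sum>i<Suc k - e. smult (coeff u i) (monom 1 i * v))"
        by (simp add: sum_distrib_right smult_monom flip: mult_smult_left)
      finally show ?thesis .
    qed
    from this[of "fst y"] this[of "snd y"]
    have "(p, q) = (\<Sum>i<Suc k - e. scale2 (coeff u i) (monom 1 i * fst y, monom 1 i * snd y))"
      unfolding u(2,3) by (simp only: prod_eq_iff fst_sum snd_sum scale2_def fst_conv snd_conv)
    also have "\<dots> \<in> upair.span ?B"
      by (intro upair.span_sum upair.span_scale upair.span_base) auto
    finally show "(p, q) \<in> upair.span ?B" .
  qed
  from upair.dim_le_card[OF this] show ?thesis
    using card_image_le[of "{..<Suc k - e}" "\<lambda>i. (monom 1 i * fst y, monom 1 i * snd y)"] by simp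
qed

text \<open>Modulo \<open>[:- t, 1:] ^ m t\<close> both pairs are multiples of
  \<open>(t, 1)\<close>.\<close>

lemma det_dvd:
  assumes "x \<in> log_pairs S m k"
  shows "(\<Prod>t\<in>S. [:- t, 1:] ^ m t) dvd pair_det x y"
proof (rule prod_linear_powers_dvd[OF finite_S])
  fix t assume t: "t \<in> S"
  have "pair_det x y = (fst x - smult t (snd x)) * snd y - snd x * (fst y - smult t (snd y))"
    by (simp add: pair_det_def algebra_simps)
  also have "[:- t, 1:] ^ m t dvd \<dots>"
    by (rule dvd_diff[OF dvd_mult2 dvd_mult]) (use t assms y_in in \<open>auto simp: log_pairs_def\<close>)
  finally show "[:- t, 1:] ^ m t dvd pair_det x y" .
qed

text \<open>Rank-nullity for the determinant with \<open>y\<close>: the kernel consists of multiples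
  of \<open>y\<close>, the image of multiples of the product of all linear powers, of degree at most
  \<open>k + e\<close>.\<close>

lemma dim_log_pairs_le:
  assumes W: "W \<subseteq> log_pairs S m k" "upair.subspace W"
  shows "upair.dim W \<le> (Suc k - e) + (Suc k + e - (\<Sum>t\<in>S. m t))"
proof -
  let ?Q = "\<Prod>t\<in>S. [:- t, 1:] ^ m t"
  let ?d = "\<lambda>x. pair_det x y"
  have "?d ` W \<subseteq> (\<lambda>s. ?Q * s) ` coeffs_below (Suc (k + e) - degree ?Q)"
  proof safe
    fix p q assume x: "(p, q) \<in> W"
    then have x': "(p, q) \<in> log_pairs S m k" using W by auto
    then have "degree p \<le> k" "degree q \<le> k" by (auto simp: log_pairs_def coeffs_below_Suc)
    then have "degree (pair_det (p, q) y) \<le> k + e"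
      unfolding pair_det_def fst_conv snd_conv using y_degree
      by (intro degree_diff_le order_trans[OF degree_mult_le] add_mono)
    then have "pair_det (p, q) y \<in> coeffs_below (Suc (k + e))" by (simp add: coeffs_below_Suc)
    then show "pair_det (p, q) y \<in> (\<lambda>s. ?Q * s) ` coeffs_below (Suc (k + e) - degree ?Q)"
      by (rule dvd_coeffs_below[OF _ det_dvd[OF x']]) (use finite_S in auto)
  qed
  from dim_le_if_subset_multiples[OF this] have "upoly.dim (?d ` W) \<le> Suc k + e - (\<Sum>t\<in>S. m t)"
    by (simp add: degree_prod_linear_powers)
  moreover have "upair.dim W = upair.dim {x \<in> W. ?d x = 0} + upoly.dim (?d ` W)"
    by (rule upair_upoly.rank_nullity[OF linear_det W(2) _ order_trans[OF W(1) log_pairs_span]]) auto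
  ultimately show ?thesis using dim_parallel_le[OF W(1)] by simp
qed

end

section \<open>Bounds for the least degree\<close>

lemma ex_minimal_log_pair:
  assumes "finite S"
  obtains e y where "minimal_log_pair S m e y" "2 * e \<le> (\<Sum>t\<in>S. m t)"
proof -
  let ?P = "\<lambda>k. \<exists>x\<in>log_pairs S m k. x \<noteq> 0"
  \<comment> \<open>The smallest degree in which the \<open>2 * Suc k\<close> coefficients outnumber
    the linear conditions.\<close>
  let ?k = "(\<Sum>t\<in>S. m t) div 2"
  have "0 < upair.dim (log_pairs S m ?k)"
    using dim_log_pairs_ge[OF assms, of ?k m] by (intro gr0I) simp
  then have k: "?P ?k" using upair.dim_pos_imp_nonzero by blast
  define e where "e = (LEAST k. ?P k)"
  obtain y where "y \<in> log_pairs S m e" "y \<noteq> 0"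
    using LeastI[of ?P, OF k] unfolding e_def by blast
  moreover have "e \<le> k" if "x \<in> log_pairs S m k" "x \<noteq> 0" for k x
    unfolding e_def by (rule Least_le) (use that in blast)
  ultimately have "minimal_log_pair S m e y" using assms by unfold_locales
  moreover have "2 * e \<le> (\<Sum>t\<in>S. m t)"
    using Least_le[of ?P, OF k] unfolding e_def by linarith
  ultimately show thesis using that by blast
qed

text \<open>The quotient of \<open>p\<close> by \<open>q\<close> has derivative zero. The argument
  is by degrees: every nonzero \<open>r\<close> whose Wronskian with \<open>q\<close> vanishes has
  the degree of \<open>q\<close>, but subtracting the right multiple of \<open>q\<close> from
  \<open>p\<close> cancels the coefficient in that degree.\<close>

lemma wronskian_eq_zeroD:
  fixes p q :: "'a::field_char_0 poly"
  assumes W: "pderiv p * q = p * pderiv q" and q: "q \<noteq> 0"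
  shows "\<exists>c. p = smult c q"
proof -
  have deg: "degree r = degree q" if "pderiv r * q = r * pderiv q" "r \<noteq> 0" for r
  proof (cases "degree r = 0 \<or> degree q = 0")
    case True
    then have "pderiv r = 0 \<or> pderiv q = 0" by (simp add: pderiv_eq_0_iff)
    then have "pderiv r = 0" "pderiv q = 0" using that q by auto
    then show ?thesis by (simp add: pderiv_eq_0_iff)
  next
    case False
    have *: "lead_coeff (pderiv s) = of_nat (degree s) * lead_coeff s" if "degree s \<noteq> 0" for s :: "'a poly"
      using that by (cases "degree s") (auto simp: degree_pderiv coeff_pderiv)
    \<comment> \<open>Characteristic zero enters here: the degrees appear as field elements, and
      their equality there gives equality as natural numbers.\<close>
    have "lead_coeff (pderiv r * q) = lead_coeff (r * pderiv q)" using that by simp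
    then have "of_nat (degree r) * (lead_coeff r * lead_coeff q) = of_nat (degree q) * (lead_coeff r * lead_coeff q)"
      using False * unfolding lead_coeff_mult by (simp add: mult_ac)
    then show ?thesis using that q by simp
  qed
  show ?thesis
  proof (cases "p = 0")
    case False
    define c where "c = lead_coeff p / lead_coeff q"
    define r where "r = p - smult c q"
    have r: "pderiv r * q = r * pderiv q"
      using W by (simp add: r_def pderiv_diff pderiv_smult algebra_simps)
    have "r = 0"
    proof (rule ccontr)
      assume "r \<noteq> 0"
      then have "coeff r (degree q) \<noteq> 0" using deg[OF r] by (metis leading_coeff_0_iff)
      moreover have "coeff r (degree q) = 0"
        using deg[OF W False] q by (simp add: r_def c_def)
      ultimately show False by simp
    qed
    then show ?thesis by (auto simp: r_def)
  qed (auto intro: exI[of _ 0])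
qed

lemma power_dvd_pderiv:
  fixes L p :: "'a::idom poly"
  assumes "L ^ k dvd p"
  shows "L ^ (k - 1) dvd pderiv p"
proof (cases k)
  case (Suc j)
  obtain u where "p = L ^ Suc j * u" using assms Suc by (auto elim: dvdE)
  then have "pderiv p = L ^ j * (smult (of_nat (Suc j)) u * pderiv L + L * pderiv u)"
    by (simp add: pderiv_mult pderiv_power_Suc algebra_simps del: power_Suc) simp
  then show ?thesis using Suc by simp
qed simp

lemma degree_sum_le_if_linear_powers_dvd:
  fixes P :: "'a::field poly"
  assumes "finite S" "\<And>t. t \<in> S \<Longrightarrow> [:- t, 1:] ^ m t dvd P" "P \<noteq> 0"
  shows "(\<Sum>t\<in>S. m t) \<le> degree P"
  using dvd_imp_degree_le[OF prod_linear_powers_dvd[OF assms(1,2)] assms(3)]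
  by (simp add: degree_prod_linear_powers)

text \<open>If the two components of \<open>y\<close> are not proportional, their Wronskian vanishes to order
  \<open>m t - 1\<close> at every \<open>t\<close>; otherwise \<open>y\<close> has a constant direction and balancedness applies.\<close>

lemma minimal_degree_bound:
  fixes S :: "'a::field_char_0 set"
  assumes "minimal_log_pair S m e y"
    and bal: "\<And>t. t \<in> S \<Longrightarrow> m t \<le> (\<Sum>s\<in>S - {t}. m s)" and card: "2 \<le> card S"
  shows "(\<Sum>t\<in>S. m t) + 2 \<le> 2 * e + card S"
proof -
  interpret minimal_log_pair S m e y by (rule assms(1))
  obtain p q where y: "y = (p, q)" by (cases y)
  have pq: "[:- t, 1:] ^ m t dvd p - smult t q" if "t \<in> S" for t
    using y_in that by (auto simp: log_pairs_def y)
  have deg: "degree p \<le> e" "degree q \<le> e" using y_degree by (auto simp: y)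
  define W where "W = pderiv p * q - p * pderiv q"
  consider "W \<noteq> 0" | "q = 0" | "W = 0" "q \<noteq> 0" by blast
  then show ?thesis
  proof cases
    case 1
    have W0: "W = 0" if "e = 0"
    proof -
      have "pderiv p = 0" "pderiv q = 0" using deg that by (simp_all add: pderiv_eq_0_iff)
      then show ?thesis by (simp add: W_def)
    qed
    then obtain j where j: "e = Suc j" using 1 by (cases e) auto
    have dp: "degree (pderiv p) \<le> j" "degree (pderiv q) \<le> j"
      using deg j by (auto simp: degree_pderiv)
    have "degree W \<le> Suc (2 * j)"
      unfolding W_def
      by (rule degree_diff_le; rule order_trans[OF degree_mult_le]) (use dp deg j in linarith)+
    \<comment> \<open>In degree \<open>2 * e - 1\<close> both products contribute \<open>e\<close>
      times the product of the coefficients at \<open>e\<close>. So \<open>W\<close> has degree at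
      most \<open>2 * e - 2\<close>, the origin of the \<open>+ 2\<close> in the claim.\<close>
    moreover have "coeff W (Suc (2 * j)) = 0"
      using coeff_mult_top[OF dp(1) deg(2)] coeff_mult_top[OF deg(1) dp(2)]
      by (simp add: W_def j coeff_pderiv mult_2)
    ultimately have "degree W < Suc (2 * j)"
      using 1 by (metis le_neq_implies_less leading_coeff_0_iff)
    moreover have "(\<Sum>t\<in>S. m t - 1) \<le> degree W"
    proof (rule degree_sum_le_if_linear_powers_dvd[OF finite_S _ 1])
      fix t assume t: "t \<in> S"
      have "[:- t, 1:] ^ (m t - 1) dvd p - smult t q"
        using pq[OF t] by (meson diff_le_self dvd_trans le_imp_power_dvd)
      moreover have "W = pderiv (p - smult t q) * q - (p - smult t q) * pderiv q"
        by (simp add: W_def pderiv_diff pderiv_smult algebra_simps)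
      ultimately show "[:- t, 1:] ^ (m t - 1) dvd W"
        using power_dvd_pderiv[OF pq[OF t]] by (simp add: dvd_diff)
    qed
    moreover have "(\<Sum>t\<in>S. m t) \<le> (\<Sum>t\<in>S. (m t - 1) + 1)"
      by (rule sum_mono) simp
    then have "(\<Sum>t\<in>S. m t) \<le> (\<Sum>t\<in>S. m t - 1) + card S"
      by (simp add: sum.distrib del: One_nat_def)
    ultimately show ?thesis using j by linarith
  next
    case 2
    then have "p \<noteq> 0" using y_nz y by (auto simp: prod_eq_iff)
    then have "(\<Sum>t\<in>S. m t) \<le> degree p"
      using pq 2 by (intro degree_sum_le_if_linear_powers_dvd finite_S) auto
    then show ?thesis using deg card by linarith
  next
    case 3
    then obtain c where c: "p = smult c q" using wronskian_eq_zeroD[of p q] by (auto simp: W_def)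
    \<comment> \<open>A field of constant direction \<open>(c, 1)\<close> satisfies the condition at
      \<open>c\<close> automatically, so only the other multiplicities bound its degree. By
      balancedness they make up at least half of the total.\<close>
    have "(\<Sum>t\<in>S - {c}. m t) \<le> degree q"
    proof (rule degree_sum_le_if_linear_powers_dvd)
      fix t assume t: "t \<in> S - {c}"
      then have "[:- t, 1:] ^ m t dvd smult (c - t) q"
        using pq[of t] c by (simp add: smult_diff_left)
      then show "[:- t, 1:] ^ m t dvd q" using t by (auto dest: dvd_smult_cancel)
    qed (use finite_S 3 in auto)
    moreover have "(\<Sum>t\<in>S. m t) \<le> 2 * (\<Sum>t\<in>S - {c}. m t)"
    proof (cases "c \<in> S")
      case True
      then show ?thesis using bal[OF True] finite_S by (simp add: sum.remove)
    qed simp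
    ultimately show ?thesis using deg card by linarith
  qed
qed

section \<open>Polynomials in two variables and homogenization\<close>

text \<open>The outer variable is x and the inner one y: \<open>coeff (coeff f i) j\<close> belongs
  to x^i * y^j. The bound on the total degree is strict, so \<open>tdeg_below 0\<close> contains
  only 0.\<close>

definition tdeg_below :: "nat \<Rightarrow> 'a::zero poly poly set" where
  "tdeg_below k = {f. \<forall>i j. k \<le> i + j \<longrightarrow> coeff (coeff f i) j = 0}"

lemma tdeg_below_coeff: "f \<in> tdeg_below k \<longleftrightarrow> (\<forall>i. coeff f i \<in> coeffs_below (k - i))"
  by (auto simp: tdeg_below_def coeffs_below_def add.commute le_diff_conv)

lemma tdeg_below_mono: "k \<le> l \<Longrightarrow> tdeg_below k \<subseteq> tdeg_below l"
  by (auto simp: tdeg_below_def)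

lemma tdeg_below_closed [intro]:
  fixes f g :: "'a::comm_ring_1 poly poly"
  shows "0 \<in> tdeg_below k"
    and "f \<in> tdeg_below k \<Longrightarrow> g \<in> tdeg_below k \<Longrightarrow> f + g \<in> tdeg_below k"
    and "f \<in> tdeg_below k \<Longrightarrow> g \<in> tdeg_below k \<Longrightarrow> f - g \<in> tdeg_below k"
    and "f \<in> tdeg_below k \<Longrightarrow> smult [:c:] f \<in> tdeg_below k"
  by (auto simp: tdeg_below_def)

lemma sum_in_tdeg_below:
  "(\<And>i. i \<in> I \<Longrightarrow> f i \<in> tdeg_below k) \<Longrightarrow> (\<Sum>i\<in>I. f i) \<in> tdeg_below k"
  for f :: "'i \<Rightarrow> 'a::comm_ring_1 poly poly"
  by (induction I rule: infinite_finite_induct) auto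

definition monom2 :: "'a::zero \<Rightarrow> nat \<Rightarrow> nat \<Rightarrow> 'a poly poly" where
  "monom2 a i j = monom (monom a j) i"

lemma coeff_monom2: "coeff (coeff (monom2 a i j) i') j' = (if i' = i \<and> j' = j then a else 0)"
  by (simp add: monom2_def)

lemma monom2_mult: "monom2 a i j * monom2 b i' j' = monom2 (a * b) (i + i') (j + j')"
  by (simp add: monom2_def mult_monom)

lemma smult_monom2: "smult [:c:] (monom2 a i j) = monom2 (c * a) i j"
  by (simp add: monom2_def smult_monom)

lemma monom2_in_tdeg_below: "i + j < k \<Longrightarrow> monom2 a i j \<in> tdeg_below k"
  by (auto simp: tdeg_below_def coeff_monom2)

definition exponents :: "nat \<Rightarrow> (nat \<times> nat) set" where
  "exponents k = {(i, j). i + j < k}"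

lemma finite_exponents [simp]: "finite (exponents k)"
  by (rule finite_subset[of _ "{..<k} \<times> {..<k}"]) (auto simp: exponents_def)

lemma mem_exponents [simp]: "(i, j) \<in> exponents k \<longleftrightarrow> i + j < k"
  by (simp add: exponents_def)

lemma tdeg_below_eq_sum:
  fixes f :: "'a::comm_ring_1 poly poly"
  assumes "f \<in> tdeg_below k"
  shows "(\<Sum>(i, j)\<in>exponents k. monom2 (coeff (coeff f i) j) i j) = f"
proof (intro poly_eqI)
  fix i j
  have "coeff (coeff (\<Sum>(i, j)\<in>exponents k. monom2 (coeff (coeff f i) j) i j) i) j
      = (\<Sum>p\<in>exponents k. if p = (i, j) then coeff (coeff f i) j else 0)"
    unfolding coeff_sum by (intro sum.cong) (auto simp: coeff_monom2 split: if_splits)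
  also have "\<dots> = coeff (coeff f i) j"
    using assms by (auto simp: tdeg_below_def)
  finally show "coeff (coeff (\<Sum>(i, j)\<in>exponents k. monom2 (coeff (coeff f i) j) i j) i) j
      = coeff (coeff f i) j" .
qed

lemma mult_eq_sum_monom2:
  fixes f g :: "'a::comm_ring_1 poly poly"
  assumes "f \<in> tdeg_below k" "g \<in> tdeg_below l"
  shows "f * g = (\<Sum>(i, j)\<in>exponents k. \<Sum>(i', j')\<in>exponents l.
    monom2 (coeff (coeff f i) j * coeff (coeff g i') j') (i + i') (j + j'))"
  by (subst tdeg_below_eq_sum[OF assms(1), symmetric], subst tdeg_below_eq_sum[OF assms(2), symmetric])
     (simp add: sum_product case_prod_unfold monom2_mult)

lemma mult_in_tdeg_below:
  fixes f g :: "'a::comm_ring_1 poly poly"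
  assumes "f \<in> tdeg_below (Suc k)" "g \<in> tdeg_below (Suc l)"
  shows "f * g \<in> tdeg_below (Suc (k + l))"
  unfolding mult_eq_sum_monom2[OF assms]
  by (auto intro!: sum_in_tdeg_below monom2_in_tdeg_below simp: exponents_def)

text \<open>One formula for two purposes: with \<open>Z\<close> a third variable it is the usual
  homogenization, and with \<open>Z = 0\<close> only the terms of degree exactly \<open>k\<close>
  survive, since \<open>0 ^ 0 = 1\<close>.\<close>

definition homogenize ::
    "('a::comm_ring_1 \<Rightarrow> 'r::comm_ring_1) \<Rightarrow> 'r \<Rightarrow> 'r \<Rightarrow> 'r \<Rightarrow> nat \<Rightarrow> 'a poly poly \<Rightarrow> 'r" where
  "homogenize c X Y Z k f =
     (\<Sum>(i, j)\<in>exponents (Suc k). c (coeff (coeff f i) j) * X ^ i * Y ^ j * Z ^ (k - (i + j)))"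

locale coefficient_hom =
  fixes c :: "'a::comm_ring_1 \<Rightarrow> 'r::comm_ring_1"
  assumes hom_add: "c (a + b) = c a + c b"
    and hom_mult: "c (a * b) = c a * c b"
    and hom_one: "c 1 = 1"
begin

lemma hom_zero: "c 0 = 0"
  using hom_add[of 0 0] by simp

lemma hom_uminus: "c (- a) = - c a"
  using hom_add[of "- a" a] hom_zero by (simp add: eq_neg_iff_add_eq_0)

lemma hom_diff: "c (a - b) = c a - c b"
  using hom_add[of a "- b"] by (simp add: hom_uminus)

context
  fixes X Y Z :: 'r
begin

lemma homogenize_add: "homogenize c X Y Z k (f + g) = homogenize c X Y Z k f + homogenize c X Y Z k g"
  by (simp add: homogenize_def hom_add algebra_simps sum.distrib case_prod_unfold)

lemma homogenize_diff: "homogenize c X Y Z k (f - g) = homogenize c X Y Z k f - homogenize c X Y Z k g"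
  by (simp add: homogenize_def hom_diff algebra_simps sum_subtractf case_prod_unfold)

lemma homogenize_smult: "homogenize c X Y Z k (smult [:a:] f) = c a * homogenize c X Y Z k f"
  by (simp add: homogenize_def hom_mult algebra_simps sum_distrib_left case_prod_unfold)

lemma homogenize_zero: "homogenize c X Y Z k 0 = 0"
  by (simp add: homogenize_def hom_zero)

lemma homogenize_sum: "homogenize c X Y Z k (\<Sum>i\<in>I. f i) = (\<Sum>i\<in>I. homogenize c X Y Z k (f i))"
  by (induction I rule: infinite_finite_induct) (auto simp: homogenize_add homogenize_zero)

lemma homogenize_monom2:
  assumes "i + j \<le> k"
  shows "homogenize c X Y Z k (monom2 a i j) = c a * X ^ i * Y ^ j * Z ^ (k - (i + j))"
proof -
  have "homogenize c X Y Z k (monom2 a i j) =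
      (\<Sum>p\<in>exponents (Suc k). if p = (i, j) then c a * X ^ i * Y ^ j * Z ^ (k - (i + j)) else 0)"
    unfolding homogenize_def by (intro sum.cong) (auto simp: coeff_monom2 hom_zero split: if_splits)
  then show ?thesis using assms by simp
qed

lemma homogenize_mult:
  assumes "f \<in> tdeg_below (Suc k)" "g \<in> tdeg_below (Suc l)"
  shows "homogenize c X Y Z (k + l) (f * g) = homogenize c X Y Z k f * homogenize c X Y Z l g"
proof -
  have *: "homogenize c X Y Z (k + l) (monom2 (a * b) (i + i') (j + j')) =
      (c a * X ^ i * Y ^ j * Z ^ (k - (i + j))) * (c b * X ^ i' * Y ^ j' * Z ^ (l - (i' + j')))"
    if "i + j \<le> k" "i' + j' \<le> l" for a b i j i' j'
  proof -
    \<comment> \<open>Truncated subtraction is additive here thanks to the two degree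
      bounds.\<close>
    have e: "k + l - (i + i' + (j + j')) = (k - (i + j)) + (l - (i' + j'))" using that by simp
    have "homogenize c X Y Z (k + l) (monom2 (a * b) (i + i') (j + j')) =
        c (a * b) * X ^ (i + i') * Y ^ (j + j') * Z ^ (k + l - (i + i' + (j + j')))"
      by (rule homogenize_monom2) (use that in simp)
    then show ?thesis unfolding e power_add hom_mult by (simp only: mult_ac)
  qed
  have "homogenize c X Y Z (k + l) (f * g) =
     (\<Sum>p\<in>exponents (Suc k). \<Sum>q\<in>exponents (Suc l).
       homogenize c X Y Z (k + l) (monom2 (coeff (coeff f (fst p)) (snd p) * coeff (coeff g (fst q)) (snd q))
         (fst p + fst q) (snd p + snd q)))"
    by (subst mult_eq_sum_monom2[OF assms]) (simp add: homogenize_sum case_prod_unfold)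
  also have "\<dots> = homogenize c X Y Z k f * homogenize c X Y Z l g"
    unfolding homogenize_def[of c X Y Z k] homogenize_def[of c X Y Z l] sum_product case_prod_unfold
    by (intro sum.cong refl *) (auto simp: exponents_def)
  finally show ?thesis .
qed

end

end

text \<open>A pair \<open>(t, c)\<close> encodes the line x = t * y + c. Substituting this
  polynomial in y for x restricts a bivariate polynomial to the line.\<close>

definition line_poly :: "'a \<times> 'a \<Rightarrow> 'a::comm_ring_1 poly" where
  "line_poly l = [:snd l, fst l:]"

definition line_eq :: "'a \<times> 'a \<Rightarrow> 'a::comm_ring_1 poly poly" where
  "line_eq l = [:- line_poly l, 1:]"

lemma degree_line_poly: "degree (line_poly l) \<le> 1"
  by (simp add: line_poly_def)

lemma inj_line_poly: "inj line_poly"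
  by (auto simp: inj_def line_poly_def prod_eq_iff)

lemma line_eq_eq_sum: "line_eq l = monom2 1 1 0 - monom2 (fst l) 0 1 - monom2 (snd l) 0 0"
  by (simp add: line_eq_def line_poly_def monom2_def monom_Suc monom_0 numeral_eq_Suc)

lemma (in coefficient_hom) homogenize_line_eq:
  "homogenize c X Y Z 1 (line_eq l) = X - c (fst l) * Y - c (snd l) * Z"
  by (simp add: line_eq_eq_sum homogenize_diff homogenize_monom2 hom_one)

lemma line_eq_in_tdeg_below: "line_eq l \<in> tdeg_below (Suc 1)"
  unfolding line_eq_eq_sum by (intro tdeg_below_closed monom2_in_tdeg_below) auto

lemma (in coefficient_hom) homogenize_prod_line_eq:
  assumes "finite V"
  shows "(\<Prod>l\<in>V. line_eq l) \<in> tdeg_below (Suc (card V))"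
    and "homogenize c X Y Z (card V) (\<Prod>l\<in>V. line_eq l) = (\<Prod>l\<in>V. X - c (fst l) * Y - c (snd l) * Z)"
  using assms
proof (induction V rule: finite_induct)
  case empty
  have one: "(1 :: 'a poly poly) = monom2 1 0 0" by (simp add: monom2_def monom_0 one_pCons)
  {
    case 1
    have "(1 :: 'a poly poly) \<in> tdeg_below (Suc 0)"
      unfolding one by (rule monom2_in_tdeg_below) simp
    then show ?case by simp
  next
    case 2
    have "homogenize c X Y Z 0 (1 :: 'a poly poly) = 1"
      unfolding one by (subst homogenize_monom2) (auto simp: hom_one)
    then show ?case by simp
  }
next
  case (insert l V)
  {
    case 1
    show ?case
      using mult_in_tdeg_below[OF line_eq_in_tdeg_below insert.IH(1), of l] insert.hyps by simp
  next
    case 2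
    show ?case
      using homogenize_mult[OF line_eq_in_tdeg_below insert.IH(1), of X Y Z l] insert.hyps insert.IH(2)
        homogenize_line_eq[of X Y Z l]
      by simp
  }
qed

lemma poly_in_coeffs_below:
  fixes f :: "'a::field poly poly"
  assumes f: "f \<in> tdeg_below k" and q: "degree q \<le> 1"
  shows "poly f q \<in> coeffs_below k"
proof -
  have "coeff f i * q ^ i \<in> coeffs_below k" for i
  proof (cases "coeff f i = 0")
    case False
    have "degree (q ^ i) \<le> degree q * i" by (rule degree_power_le)
    also have "\<dots> \<le> i" using q by (cases "degree q") auto
    finally have "degree (coeff f i * q ^ i) \<le> degree (coeff f i) + i"
      using degree_mult_le order_trans add_left_mono by blast
    moreover have "degree (coeff f i) < k - i"
      using f False by (auto simp: tdeg_below_coeff coeffs_below_iff)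
    ultimately show ?thesis by (auto simp: coeffs_below_iff)
  qed (auto simp: coeffs_below_def)
  then show ?thesis
    unfolding poly_altdef by (intro upoly.subspace_sum subspace_coeffs_below) auto
qed

text \<open>Synthetic division by the monic linear polynomial \<open>x - q\<close> in \<open>x\<close>.\<close>

lemma quotient_in_tdeg_below:
  fixes H :: "'a::field poly poly"
  assumes f: "[:- q, 1:] * H \<in> tdeg_below k" and q: "degree q \<le> 1"
  shows "H \<in> tdeg_below (k - 1)"
proof -
  let ?f = "[:- q, 1:] * H"
  have rec: "coeff H i = coeff ?f (Suc i) + q * coeff H (Suc i)" for i
    by simp
  \<comment> \<open>Downward induction on the index: \<open>n\<close> measures how far below the
    degree of \<open>H\<close> the claim reaches.\<close>
  have all: "\<forall>i. degree H < i + n \<longrightarrow> coeff H i \<in> coeffs_below (k - 1 - i)" for n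
  proof (induction n)
    case 0
    then show ?case by (auto simp: coeff_eq_0 coeffs_below_def)
  next
    case (Suc n)
    show ?case
    proof (intro allI impI)
      fix i assume "degree H < i + Suc n"
      then have IH: "coeff H (Suc i) \<in> coeffs_below (k - 1 - Suc i)" using Suc by simp
      have "q * coeff H (Suc i) \<in> coeffs_below (k - 1 - i)"
        using IH q degree_mult_le[of q "coeff H (Suc i)"] by (auto simp: coeffs_below_iff)
      moreover have "coeff ?f (Suc i) \<in> coeffs_below (k - 1 - i)"
        using f[unfolded tdeg_below_coeff, rule_format, of "Suc i"] by simp
      ultimately show "coeff H i \<in> coeffs_below (k - 1 - i)"
        unfolding rec[of i] using subspace_coeffs_below upoly.subspace_add by blast
    qed
  qed
  then have "coeff H i \<in> coeffs_below (k - 1 - i)" for i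
    using all[of "Suc (degree H)"] by simp
  then show ?thesis by (simp add: tdeg_below_coeff)
qed

text \<open>Lines are split off one at a time: the product of the earlier equations does not vanish
  identically on a further line, so the cofactor does.\<close>

lemma prod_line_eq_quotient:
  fixes f :: "'a::field poly poly"
  assumes "finite T" "f \<in> tdeg_below k" "\<And>l. l \<in> T \<Longrightarrow> poly f (line_poly l) = 0"
  shows "\<exists>H\<in>tdeg_below (k - card T). f = (\<Prod>l\<in>T. line_eq l) * H"
  using assms
proof (induction T rule: finite_induct)
  case (insert l T)
  then obtain H where H: "H \<in> tdeg_below (k - card T)" "f = (\<Prod>l\<in>T. line_eq l) * H" by auto
  have "poly (\<Prod>l\<in>T. line_eq l) (line_poly l) \<noteq> 0"
    using insert.hyps by (auto simp: poly_prod line_eq_def dest: injD[OF inj_line_poly])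
  moreover have "poly f (line_poly l) = 0" using insert.prems by simp
  ultimately have "poly H (line_poly l) = 0" unfolding H(2) by simp
  then obtain H' where H': "H = line_eq l * H'"
    unfolding poly_eq_0_iff_dvd line_eq_def by (auto elim: dvdE)
  have "H' \<in> tdeg_below (k - card T - 1)"
    by (rule quotient_in_tdeg_below[OF _ degree_line_poly[of l]]) (use H(1) H' in \<open>simp add: line_eq_def\<close>)
  then show ?case using H(2) H' insert.hyps by (intro bexI[of _ H']) (auto simp: mult_ac)
qed auto

section \<open>Vector fields tangent to affine lines\<close>

definition scale3 :: "'a::field \<Rightarrow> 'a poly poly \<times> 'a poly poly \<Rightarrow> 'a poly poly \<times> 'a poly poly" where
  "scale3 c x = (smult [:c:] (fst x), smult [:c:] (snd x))"

interpretation bpair: vector_space "scale3 :: 'a::field \<Rightarrow> _"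
proof unfold_locales
  have *: "[:a + b:] = [:a:] + [:b:]" for a b :: 'a by simp
  show "scale3 (a + b) x = scale3 a x + scale3 b x" for a b :: 'a and x
    unfolding scale3_def * smult_add_left by simp
qed (auto simp: scale3_def smult_add_right one_pCons[symmetric] mult.commute)

interpretation bpair_upair: vector_space_pair "scale3 :: 'a::field \<Rightarrow> _" "scale2 :: 'a \<Rightarrow> _"
  by unfold_locales

interpretation bpair_upoly: vector_space_pair "scale3 :: 'a::field \<Rightarrow> _" "smult :: 'a \<Rightarrow> 'a poly \<Rightarrow> 'a poly"
  by unfold_locales

text \<open>The derivative of the equation x - t * y - c along the field. It depends only on the
  slope t, so parallel lines share it.\<close>

definition along :: "'a \<times> 'a \<Rightarrow> 'a::field poly poly \<times> 'a poly poly \<Rightarrow> 'a poly poly" where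
  "along l x = fst x - smult [:fst l:] (snd x)"

text \<open>The strict degree bound makes \<open>log_fields T k\<close> the kernel of
  \<open>top_pair k\<close> on \<open>log_fields T (Suc k)\<close>.\<close>

definition log_fields :: "('a::field \<times> 'a) set \<Rightarrow> nat \<Rightarrow> ('a poly poly \<times> 'a poly poly) set" where
  "log_fields T k = {x \<in> tdeg_below k \<times> tdeg_below k. \<forall>l\<in>T. poly (along l x) (line_poly l) = 0}"

lemma log_fields_subset: "log_fields T k \<subseteq> tdeg_below k \<times> tdeg_below k"
  by (auto simp: log_fields_def)

lemma linear_along: "Vector_Spaces.linear scale3 smult (\<lambda>x. poly (along l x) q)"
  by unfold_locales (auto simp: along_def scale3_def algebra_simps smult_diff_right)

lemma along_in_tdeg_below: "x \<in> log_fields T k \<Longrightarrow> along l x \<in> tdeg_below k"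
  unfolding along_def by (intro tdeg_below_closed) (auto simp: log_fields_def)

lemma subspace_tdeg_below: "bpair.subspace (tdeg_below k \<times> tdeg_below k)"
  by (auto simp: bpair.subspace_def scale3_def mem_Times_iff simp del: mem_Sigma_iff)

lemma subspace_log_fields: "bpair.subspace (log_fields T k)"
proof -
  interpret l: Vector_Spaces.linear scale3 smult "\<lambda>x. poly (along l x) (line_poly l)" for l :: "'a \<times> 'a"
    by (rule linear_along)
  show ?thesis
    using subspace_tdeg_below[of k, where 'a='a]
    by (auto simp: bpair.subspace_def log_fields_def l.add l.scale l.zero simp del: mem_Sigma_iff)
qed

definition bpair_monoms :: "nat \<Rightarrow> ('a::field poly poly \<times> 'a poly poly) set" where
  "bpair_monoms k = (\<lambda>(i, j). (monom2 1 i j, 0)) ` exponents k \<union> (\<lambda>(i, j). (0, monom2 1 i j)) ` exponents k"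

lemma finite_bpair_monoms [simp]: "finite (bpair_monoms k)"
  by (simp add: bpair_monoms_def)

lemma tdeg_below_span: "tdeg_below k \<times> tdeg_below k \<subseteq> bpair.span (bpair_monoms k)"
proof safe
  fix f g :: "'a poly poly" assume f: "f \<in> tdeg_below k" and g: "g \<in> tdeg_below k"
  have "(f, g) = (\<Sum>(i, j)\<in>exponents k. scale3 (coeff (coeff f i) j) (monom2 1 i j, 0))
      + (\<Sum>(i, j)\<in>exponents k. scale3 (coeff (coeff g i) j) (0, monom2 1 i j))"
    using tdeg_below_eq_sum[OF f] tdeg_below_eq_sum[OF g]
    by (simp add: scale3_def prod_eq_iff fst_sum snd_sum smult_monom2 case_prod_unfold)
  also have "\<dots> \<in> bpair.span (bpair_monoms k)"
    by (intro bpair.span_add bpair.span_sum; clarify; intro bpair.span_scale bpair.span_base)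
       (auto simp: bpair_monoms_def)
  finally show "(f, g) \<in> bpair.span (bpair_monoms k)" .
qed

lemma log_fields_span: "log_fields T k \<subseteq> bpair.span (bpair_monoms k)"
  using log_fields_subset tdeg_below_span by (rule order_trans)

text \<open>The part of degree \<open>k\<close>, dehomogenized: restriction to the line at infinity.\<close>

definition top_part :: "nat \<Rightarrow> 'a::field poly poly \<Rightarrow> 'a poly" where
  "top_part = homogenize (\<lambda>a. [:a:]) [:0, 1:] 1 0"

interpretation const_poly: coefficient_hom "\<lambda>a :: 'a::field. [:a:]"
  by unfold_locales (auto simp: one_pCons)

lemma coeff_top_part: "coeff (top_part k f) i = (if i \<le> k then coeff (coeff f i) (k - i) else 0)"
proof -
  have X: "[:0, 1::'a:] ^ n = monom 1 n" for n
    by (simp add: monom_altdef)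
  have *: "coeff ([:coeff (coeff f a) b:] * [:0, 1:] ^ a * 1 ^ b * 0 ^ (k - (a + b))) i =
      (if (a, b) = (i, k - i) then coeff (coeff f i) (k - i) else 0)" if "a + b \<le> k" for a b
    using that by (cases "a + b = k") (auto simp: X power_0_left)
  have "coeff (top_part k f) i =
      (\<Sum>p\<in>exponents (Suc k). if p = (i, k - i) then coeff (coeff f i) (k - i) else 0)"
    unfolding top_part_def homogenize_def coeff_sum
    by (intro sum.cong refl) (auto simp only: split_paired_all prod.case mem_exponents less_Suc_eq_le *)
  also have "\<dots> = (if i \<le> k then coeff (coeff f i) (k - i) else 0)"
    by auto
  finally show ?thesis .
qed

lemma top_part_in_coeffs_below: "top_part k f \<in> coeffs_below (Suc k)"
  by (auto simp: coeffs_below_def coeff_top_part)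

lemma top_part_eq_0_iff:
  assumes "f \<in> tdeg_below (Suc k)"
  shows "top_part k f = 0 \<longleftrightarrow> f \<in> tdeg_below k"
proof
  assume z: "top_part k f = 0"
  have "coeff (coeff f i) j = 0" if "k \<le> i + j" for i j
  proof (cases "i + j = k")
    case True
    then show ?thesis using coeff_top_part[of k f i] z by auto
  next
    case False
    then show ?thesis using assms that by (auto simp: tdeg_below_def)
  qed
  then show "f \<in> tdeg_below k" by (simp add: tdeg_below_def)
qed (auto simp: tdeg_below_def poly_eq_iff coeff_top_part)

lemma top_part_mult:
  "f \<in> tdeg_below (Suc k) \<Longrightarrow> g \<in> tdeg_below (Suc l) \<Longrightarrow> top_part (k + l) (f * g) = top_part k f * top_part l g"
  unfolding top_part_def by (rule const_poly.homogenize_mult)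

lemma top_part_diff: "top_part k (f - g) = top_part k f - top_part k g"
  unfolding top_part_def by (rule const_poly.homogenize_diff)

lemma top_part_add: "top_part k (f + g) = top_part k f + top_part k g"
  unfolding top_part_def by (rule const_poly.homogenize_add)

lemma top_part_smult: "top_part k (smult [:c:] f) = smult c (top_part k f)"
  unfolding top_part_def by (simp add: const_poly.homogenize_smult)

definition top_pair :: "nat \<Rightarrow> 'a::field poly poly \<times> 'a poly poly \<Rightarrow> 'a poly \<times> 'a poly" where
  "top_pair k x = (top_part k (fst x), top_part k (snd x))"

lemma linear_top_pair: "Vector_Spaces.linear scale3 scale2 (top_pair k)"
  by unfold_locales (auto simp: top_pair_def scale3_def scale2_def top_part_add top_part_smult)

text \<open>By this filtration the dimension is a sum of dimensions of spaces of leading parts, the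
  form in which the two bounds are compared.\<close>

lemma dim_log_fields_Suc:
  "bpair.dim (log_fields T (Suc k)) = bpair.dim (log_fields T k) + upair.dim (top_pair k ` log_fields T (Suc k))"
proof -
  have "{x \<in> log_fields T (Suc k). top_pair k x = 0} = log_fields T k"
    using tdeg_below_mono[of k "Suc k", where 'a='a]
    by (auto simp: log_fields_def top_pair_def prod_eq_iff top_part_eq_0_iff)
  moreover have "bpair.dim (log_fields T (Suc k)) =
      bpair.dim {x \<in> log_fields T (Suc k). top_pair k x = 0} + upair.dim (top_pair k ` log_fields T (Suc k))"
    by (rule bpair_upair.rank_nullity[OF linear_top_pair subspace_log_fields _ log_fields_span]) simp
  ultimately show ?thesis by simp
qed

lemma dim_log_fields_0: "bpair.dim (log_fields T 0) = 0"
proof -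
  have "log_fields T 0 \<subseteq> bpair.span {}"
    by (auto simp: log_fields_def tdeg_below_def prod_eq_iff poly_eq_iff)
  from bpair.dim_le_card[OF this] show ?thesis by simp
qed

lemma dim_log_fields_empty: "bpair.dim (log_fields {} k :: ('a::field poly poly \<times> 'a poly poly) set) = k * (k + 1)"
proof (induction k)
  case 0
  then show ?case by (simp add: dim_log_fields_0)
next
  case (Suc k)
  have "p \<in> top_part k ` tdeg_below (Suc k)" if "p \<in> coeffs_below (Suc k)" for p :: "'a poly"
  proof (rule image_eqI)
    \<comment> \<open>The homogeneous polynomial of degree \<open>k\<close> that dehomogenizes to
      \<open>p\<close>.\<close>
    let ?f = "\<Sum>i\<le>k. monom2 (coeff p i) i (k - i)"
    show "?f \<in> tdeg_below (Suc k)"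
      by (intro sum_in_tdeg_below monom2_in_tdeg_below) auto
    have "coeff (coeff ?f i) (k - i) = coeff p i" if "i \<le> k" for i
    proof -
      have "coeff (coeff ?f i) (k - i) = (\<Sum>i'\<le>k. if i' = i then coeff p i else 0)"
        unfolding coeff_sum by (intro sum.cong) (auto simp: coeff_monom2)
      then show ?thesis using that by simp
    qed
    then show "p = top_part k ?f"
      using that by (auto simp: poly_eq_iff coeff_top_part coeffs_below_def)
  qed
  then have surj: "top_part k ` tdeg_below (Suc k) = (coeffs_below (Suc k) :: 'a poly set)"
    using top_part_in_coeffs_below by auto
  have "top_pair k ` log_fields {} (Suc k) = map_prod (top_part k) (top_part k) ` (tdeg_below (Suc k) \<times> (tdeg_below (Suc k) :: 'a poly poly set))"
    unfolding log_fields_def top_pair_def by (intro image_cong) auto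
  also have "\<dots> = coeffs_below (Suc k) \<times> coeffs_below (Suc k)"
    by (rule map_prod_surj_on[OF surj surj])
  finally show ?case
    using dim_log_fields_Suc[of "{} :: ('a \<times> 'a) set" k] dim_pairs[of "Suc k", where 'a='a] Suc
    by simp
qed

abbreviation multiplicity_at :: "('a \<times> 'a) set \<Rightarrow> 'a \<Rightarrow> nat" where
  "multiplicity_at T t \<equiv> card {l \<in> T. fst l = t}"

text \<open>All lines of slope \<open>t\<close> share the polynomial \<open>g\<close>. It is
  divisible by each of their equations, whose leading parts are all \<open>[:- t, 1:]\<close>, so
  the leading part of \<open>g\<close> acquires one factor for every such line.\<close>

lemma top_pair_in_log_pairs:
  assumes "finite T" "x \<in> log_fields T (Suc k)"
  shows "top_pair k x \<in> log_pairs (fst ` T) (multiplicity_at T) k"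
proof -
  have "[:- t, 1:] ^ multiplicity_at T t dvd top_part k (fst x) - smult t (top_part k (snd x))" for t
  proof -
    let ?Tt = "{l \<in> T. fst l = t}"
    define g where "g = fst x - smult [:t:] (snd x)"
    have g: "g \<in> tdeg_below (Suc k)" "poly g (line_poly l) = 0" if "l \<in> ?Tt" for l
      using assms that along_in_tdeg_below[OF assms(2), of l] by (auto simp: log_fields_def g_def along_def)
    have g1: "g \<in> tdeg_below (Suc k)"
      using along_in_tdeg_below[OF assms(2), of "(t, 0)"] by (simp add: g_def along_def)
    have "[:- t, 1:] ^ card U dvd top_part k g" if U: "finite U" "U \<subseteq> ?Tt" for U
    proof -
      obtain H where H: "H \<in> tdeg_below (Suc k - card U)" "g = (\<Prod>l\<in>U. line_eq l) * H"
        using prod_line_eq_quotient[OF U(1) g1] g U(2) by blast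
      show ?thesis
      proof (cases "card U \<le> k")
        case False
        \<comment> \<open>More parallel lines than the degree allows force
          \<open>g = 0\<close>.\<close>
        then have "H \<in> tdeg_below 0" using H(1) by simp
        then have "H = 0" by (auto simp: tdeg_below_def poly_eq_iff)
        then show ?thesis using H(2) by (simp add: top_part_def const_poly.homogenize_zero)
      next
        case True
        have "top_part (card U) (\<Prod>l\<in>U. line_eq l) = (\<Prod>l\<in>U. [:- t, 1:])"
          unfolding top_part_def const_poly.homogenize_prod_line_eq(2)[OF U(1)]
          by (rule prod.cong) (use U(2) in auto)
        then have prod: "top_part (card U) (\<Prod>l\<in>U. line_eq l) = [:- t, 1:] ^ card U" by simp
        have "top_part (card U + (k - card U)) g = [:- t, 1:] ^ card U * top_part (k - card U) H"
          unfolding H(2) using const_poly.homogenize_prod_line_eq(1)[OF U(1)] prod H(1) True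
          by (subst top_part_mult) (auto simp: Suc_diff_le)
        then show ?thesis using True by simp
      qed
    qed
    from this[of ?Tt] show ?thesis
      using assms(1) by (simp add: g_def top_part_diff top_part_smult)
  qed
  then show ?thesis
    using top_part_in_coeffs_below by (auto simp: log_pairs_def top_pair_def)
qed

section \<open>Counting intersection points\<close>

text \<open>The constant term of the characteristic polynomial, since a point on r >= 2 lines has
  Moebius value r - 1. Taking a family \<open>I\<close> covers sheared lines, original lines, and
  sets of lines with \<open>I = id\<close>.\<close>

definition excess :: "('l \<Rightarrow> 'p set) \<Rightarrow> 'l set \<Rightarrow> nat" where
  "excess I T = (\<Sum>p\<in>{p. \<exists>k\<in>T. \<exists>l\<in>T. k \<noteq> l \<and> p \<in> I k \<inter> I l}. card {l \<in> T. p \<in> I l} - 1)"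

text \<open>Exactly the points where the new member meets an earlier one gain a line.\<close>

lemma excess_insert:
  assumes "finite T" "l \<notin> T"
    and fin: "\<And>j k. j \<in> insert l T \<Longrightarrow> k \<in> insert l T \<Longrightarrow> j \<noteq> k \<Longrightarrow> finite (I j \<inter> I k)"
  shows "excess I (insert l T) = excess I T + card (\<Union>k\<in>T. I l \<inter> I k)"
proof -
  let ?P = "\<lambda>T. {p. \<exists>k\<in>T. \<exists>l\<in>T. k \<noteq> l \<and> p \<in> I k \<inter> I l}"
  let ?r = "\<lambda>T p. card {l \<in> T. p \<in> I l}"
  let ?N = "\<Union>k\<in>T. I l \<inter> I k"
  have "?P (insert l T) \<subseteq> (\<Union>j\<in>insert l T. \<Union>k\<in>insert l T - {j}. I j \<inter> I k)" by blast
  moreover have "finite (\<Union>j\<in>insert l T. \<Union>k\<in>insert l T - {j}. I j \<inter> I k)"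
    using assms(1) by (intro finite_UN_I fin) auto
  ultimately have finP: "finite (?P (insert l T))" by (rule finite_subset)
  have N: "?N \<subseteq> ?P (insert l T)"
  proof
    fix p assume "p \<in> ?N"
    then obtain k where "k \<in> T" "p \<in> I l" "p \<in> I k" by auto
    moreover from this have "l \<noteq> k" using assms(2) by auto
    ultimately show "p \<in> ?P (insert l T)" by auto
  qed
  \<comment> \<open>Points on at most one old member count 0 by the truncated \<open>- 1\<close>, so
    the sum may run over the larger set of points.\<close>
  have old: "excess I T = (\<Sum>p\<in>?P (insert l T). ?r T p - 1)"
    unfolding excess_def
  proof (rule sum.mono_neutral_left[OF finP])
    show "?P T \<subseteq> ?P (insert l T)" by blast
    show "\<forall>p\<in>?P (insert l T) - ?P T. ?r T p - 1 = 0"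
    proof
      fix p assume "p \<in> ?P (insert l T) - ?P T"
      then have "\<forall>j\<in>{l \<in> T. p \<in> I l}. \<forall>k\<in>{l \<in> T. p \<in> I l}. j = k" by blast
      then have "card {l \<in> T. p \<in> I l} \<le> Suc 0" using assms(1) by (subst card_le_Suc0_iff_eq) auto
      then show "?r T p - 1 = 0" by simp
    qed
  qed
  have new: "?r (insert l T) p - 1 = (?r T p - 1) + (if p \<in> ?N then 1 else 0)"
    if p: "p \<in> ?P (insert l T)" for p
  proof (cases "p \<in> ?N")
    case True
    then have "{k \<in> insert l T. p \<in> I k} = insert l {k \<in> T. p \<in> I k}" by blast
    then have "?r (insert l T) p = Suc (?r T p)" using assms(1,2) by simp
    moreover have "?r T p > 0" using True assms(1) by (auto simp: card_gt_0_iff)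
    ultimately show ?thesis using True by simp
  next
    case False
    then have "p \<notin> I l" using p by auto
    then have "{k \<in> insert l T. p \<in> I k} = {k \<in> T. p \<in> I k}" by blast
    then show ?thesis using False by simp
  qed
  have indicator: "(\<Sum>p\<in>P. if p \<in> N then 1 else 0 :: nat) = card N" if "finite P" "N \<subseteq> P" for P N :: "'b set"
    using that by (simp add: sum.If_cases Int_absorb1)
  have "excess I (insert l T) = (\<Sum>p\<in>?P (insert l T). (?r T p - 1) + (if p \<in> ?N then 1 else 0))"
    unfolding excess_def by (rule sum.cong[OF refl new])
  then show ?thesis by (simp only: sum.distrib old indicator[OF finP N])
qed

section \<open>Intersection points on one line and the cost of tangency to it\<close>

definition line_points :: "'a::field \<times> 'a \<Rightarrow> ('a \<times> 'a) set" where
  "line_points l = {p. fst p = fst l * snd p + snd l}"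

text \<open>The \<open>y\<close>-coordinate of the intersection point of two lines of different slopes.\<close>

definition crossing :: "'a::field \<times> 'a \<Rightarrow> 'a \<times> 'a \<Rightarrow> 'a" where
  "crossing l k = (snd k - snd l) / (fst l - fst k)"

lemma crossing_eq_iff:
  assumes "fst k \<noteq> fst l"
  shows "crossing l k = y \<longleftrightarrow> fst l * y + snd l = fst k * y + snd k"
proof -
  have "crossing l k = y \<longleftrightarrow> snd k - snd l = y * (fst l - fst k)"
    using assms by (simp add: crossing_def divide_eq_eq)
  also have "\<dots> \<longleftrightarrow> fst l * y + snd l = fst k * y + snd k"
    by (simp add: algebra_simps) (metis add.commute)
  finally show ?thesis .
qed

lemma line_points_Int:
  assumes "k \<noteq> l"
  shows "line_points l \<inter> line_points k =
    (if fst k = fst l then {} else {(fst l * crossing l k + snd l, crossing l k)})"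
proof (cases "fst k = fst l")
  case True
  then show ?thesis using assms by (auto simp: line_points_def prod_eq_iff)
next
  case False
  have "p \<in> line_points l \<inter> line_points k \<longleftrightarrow>
      fst p = fst l * snd p + snd l \<and> fst l * snd p + snd l = fst k * snd p + snd k" for p
    by (auto simp: line_points_def)
  also have "\<dots> p \<longleftrightarrow> p = (fst l * crossing l k + snd l, crossing l k)" for p
    unfolding crossing_eq_iff[OF False, symmetric] by (auto simp: prod_eq_iff)
  finally show ?thesis using False by auto
qed

lemma card_crossings:
  assumes "l \<notin> T"
  shows "card (\<Union>k\<in>T. line_points l \<inter> line_points k) = card (crossing l ` {k \<in> T. fst k \<noteq> fst l})"
proof -
  have "(\<Union>k\<in>T. line_points l \<inter> line_points k) =
      (\<Union>k\<in>T. if fst k = fst l then {} else {(fst l * crossing l k + snd l, crossing l k)})"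
    using assms by (intro SUP_cong refl line_points_Int) auto
  also have "\<dots> = (\<lambda>y. (fst l * y + snd l, y)) ` crossing l ` {k \<in> T. fst k \<noteq> fst l}"
    by (auto split: if_splits)
  finally show ?thesis by (simp add: card_image inj_on_def)
qed

text \<open>\<open>along l x\<close> is divisible by the equations of all lines of \<open>T\<close>
  parallel to \<open>l\<close>. Those equations are constant on \<open>l\<close>, so each of them
  lowers the degree bound of the restriction by one.\<close>

lemma along_on_parallels:
  assumes "finite T" "x \<in> log_fields T K"
  shows "poly (along l x) (line_poly l) \<in> coeffs_below (K - card {k \<in> T. fst k = fst l})"
proof -
  let ?Tp = "{k \<in> T. fst k = fst l}"
  have "poly (along l x) (line_poly k) = 0" if "k \<in> ?Tp" for k
    using assms(2) that by (auto simp: log_fields_def along_def)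
  then obtain H where H: "H \<in> tdeg_below (K - card ?Tp)" "along l x = (\<Prod>k\<in>?Tp. line_eq k) * H"
    using prod_line_eq_quotient[of ?Tp "along l x" K] along_in_tdeg_below[OF assms(2)] assms(1) by auto
  have "degree (\<Prod>k\<in>?Tp. poly (line_eq k) (line_poly l)) \<le> (\<Sum>k\<in>?Tp. 0)"
    using assms(1)
    by (intro order_trans[OF degree_prod_sum_le] sum_mono) (auto simp: line_eq_def line_poly_def)
  moreover have "poly (along l x) (line_poly l) = (\<Prod>k\<in>?Tp. poly (line_eq k) (line_poly l)) * poly H (line_poly l)"
    by (simp add: H(2) poly_prod)
  moreover have "poly H (line_poly l) \<in> coeffs_below (K - card ?Tp)"
    by (rule poly_in_coeffs_below[OF H(1) degree_line_poly])
  ultimately show ?thesis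
    using degree_mult_le[of "\<Prod>k\<in>?Tp. poly (line_eq k) (line_poly l)" "poly H (line_poly l)"]
    by (auto simp: coeffs_below_iff)
qed

text \<open>The determinant of \<open>x\<close> with the Euler field centred at the point is divisible by the equations of
  all lines through the point, and on \<open>l\<close> it equals the normal component of \<open>x\<close> times one further
  linear factor.\<close>

lemma along_at_crossing:
  assumes "finite T" "x \<in> log_fields T K"
  shows "[:- y, 1:] ^ (card {k \<in> T. fst k \<noteq> fst l \<and> crossing l k = y} - 1) dvd poly (along l x) (line_poly l)"
proof (cases "card {k \<in> T. fst k \<noteq> fst l \<and> crossing l k = y}")
  case (Suc r)
  let ?U = "{k \<in> T. fst k \<noteq> fst l \<and> crossing l k = y}"
  define x0 where "x0 = fst l * y + snd l"
  define \<delta> where "\<delta> = fst x * (monom2 1 0 1 - monom2 y 0 0) - snd x * line_eq (0, x0)"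
  \<comment> \<open>Used for the lines of \<open>?U\<close>, where the right-hand side is zero, and
    for \<open>l\<close> itself, where it contains the polynomial in question.\<close>
  have \<delta>_poly: "poly \<delta> (line_poly k) = [:- y, 1:] * poly (along k x) (line_poly k)"
    if "x0 = fst k * y + snd k" for k
  proof -
    have "monom2 1 0 1 - monom2 y 0 0 = [:[:- y, 1:]:]"
      by (simp add: monom2_def monom_0 monom_Suc)
    moreover have "line_poly k - line_poly (0, x0) = smult (fst k) [:- y, 1:]"
      using that by (simp add: line_poly_def)
    ultimately show ?thesis
      by (simp add: \<delta>_def line_eq_def along_def algebra_simps smult_diff_right)
  qed
  have through: "x0 = fst k * y + snd k" if "k \<in> ?U" for k
    using that crossing_eq_iff[of k l y] by (auto simp: x0_def)
  have "\<delta> \<in> tdeg_below (Suc (K + 1))"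
  proof -
    have "fst x \<in> tdeg_below (Suc K)" "snd x \<in> tdeg_below (Suc K)"
      using assms(2) tdeg_below_mono[of K "Suc K", where 'a='a] by (auto simp: log_fields_def)
    moreover have "monom2 1 0 1 - monom2 y 0 0 \<in> tdeg_below (Suc 1)"
      by (intro tdeg_below_closed monom2_in_tdeg_below) auto
    ultimately show ?thesis
      unfolding \<delta>_def by (intro tdeg_below_closed(3)[OF mult_in_tdeg_below mult_in_tdeg_below] line_eq_in_tdeg_below)
  qed
  moreover have "poly \<delta> (line_poly k) = 0" if "k \<in> ?U" for k
    using \<delta>_poly[OF through[OF that]] assms(2) that by (simp add: log_fields_def)
  ultimately obtain H where H: "\<delta> = (\<Prod>k\<in>?U. line_eq k) * H"
    using prod_line_eq_quotient[of ?U \<delta> "Suc (K + 1)"] assms(1) by auto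
  have "poly (line_eq k) (line_poly l) = smult (fst l - fst k) [:- y, 1:]" if "k \<in> ?U" for k
    using through[OF that] by (simp add: line_eq_def line_poly_def x0_def algebra_simps) 
  then have "(\<Prod>k\<in>?U. poly (line_eq k) (line_poly l)) = (\<Prod>k\<in>?U. smult (fst l - fst k) [:- y, 1:])"
    by (intro prod.cong refl) blast
  then have "(\<Prod>k\<in>?U. poly (line_eq k) (line_poly l)) = smult (\<Prod>k\<in>?U. fst l - fst k) ([:- y, 1:] ^ card ?U)"
    unfolding prod_smult by simp
  then have "[:- y, 1:] ^ card ?U dvd poly \<delta> (line_poly l)"
    unfolding H by (simp add: poly_prod dvd_smult)
  also have "poly \<delta> (line_poly l) = [:- y, 1:] * poly (along l x) (line_poly l)"
    by (rule \<delta>_poly) (simp add: x0_def)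
  finally show ?thesis
    unfolding Suc by (simp only: power_Suc dvd_mult_cancel_left diff_Suc_1) simp
qed simp

text \<open>The cost of tangency to \<open>l\<close> is the dimension of the space of restrictions
  of \<open>along l x\<close> to \<open>l\<close>. Each parallel line lowers their degree by one,
  and a crossing with r lines of \<open>T\<close> forces a zero of order r - 1. Each line of
  \<open>T\<close> thus reduces the cost by one, up to a loss of one per crossing point.\<close>

lemma dim_log_fields_insert:
  assumes fin: "finite T" and l: "l \<notin> T"
  shows "bpair.dim (log_fields T K) \<le> bpair.dim (log_fields (insert l T) K)
    + (K - (card T - card (\<Union>k\<in>T. line_points l \<inter> line_points k)))"
proof -
  let ?\<phi> = "\<lambda>x. poly (along l x) (line_poly l)"
  define Tn where "Tn = {k \<in> T. fst k \<noteq> fst l}"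
  define Tp where "Tp = {k \<in> T. fst k = fst l}"
  define Y where "Y = crossing l ` Tn"
  define r where "r = (\<lambda>y. card {k \<in> Tn. crossing l k = y})"
  define E where "E = (\<Prod>y\<in>Y. [:- y, 1:] ^ (r y - 1))"
  have finT: "finite Tn" "finite Tp" "finite Y" using fin by (auto simp: Tn_def Tp_def Y_def)
  have r_pos: "1 \<le> r y" if "y \<in> Y" for y
    using that finT unfolding r_def Y_def by (auto simp: Suc_le_eq card_gt_0_iff)
  have "card Tn = (\<Sum>y\<in>Y. r y)"
    using sum.image_gen[OF finT(1), of "\<lambda>_. 1::nat" "crossing l"] by (simp add: Y_def r_def)
  then have "(\<Sum>y\<in>Y. r y - 1) = card Tn - card Y"
    using r_pos by (simp add: sum_subtractf_nat)
  then have degE: "degree E = card Tn - card Y"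
    unfolding E_def degree_prod_linear_powers .
  have "?\<phi> x \<in> (\<lambda>s. E * s) ` coeffs_below (K - card Tp - degree E)" if x: "x \<in> log_fields T K" for x
  proof (rule dvd_coeffs_below)
    show "?\<phi> x \<in> coeffs_below (K - card Tp)"
      unfolding Tp_def by (rule along_on_parallels[OF fin x])
    show "E dvd ?\<phi> x"
      unfolding E_def
    proof (rule prod_linear_powers_dvd[OF finT(3)])
      fix y
      show "[:- y, 1:] ^ (r y - 1) dvd ?\<phi> x"
        using along_at_crossing[OF fin x, of y l] by (simp add: r_def Tn_def conj_assoc)
    qed
    show "E \<noteq> 0" using finT(3) by (auto simp: E_def)
  qed
  then have "upoly.dim (?\<phi> ` log_fields T K) \<le> K - card Tp - degree E"
    by (intro dim_le_if_subset_multiples[of _ E]) auto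
  moreover have "card T = card Tp + card Tn"
  proof -
    have "T = Tp \<union> Tn" "Tp \<inter> Tn = {}" by (auto simp: Tn_def Tp_def)
    then show ?thesis using card_Un_disjoint[OF finT(2,1)] by simp
  qed
  moreover have "card Y \<le> card Tn" unfolding Y_def by (rule card_image_le[OF finT(1)])
  moreover have "card (\<Union>k\<in>T. line_points l \<inter> line_points k) = card Y"
    using card_crossings[OF l] by (simp add: Y_def Tn_def)
  moreover have "{x \<in> log_fields T K. ?\<phi> x = 0} = log_fields (insert l T) K"
    by (auto simp: log_fields_def)
  moreover have "bpair.dim (log_fields T K) =
      bpair.dim {x \<in> log_fields T K. ?\<phi> x = 0} + upoly.dim (?\<phi> ` log_fields T K)"
    by (rule bpair_upoly.rank_nullity[OF linear_along subspace_log_fields _ log_fields_span]) simp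
  ultimately show ?thesis using degE by simp
qed

text \<open>With j lines present and c crossing points on the next line, the cost is K - j + c. The
  sum is n * K - n * (n - 1) / 2 + b; doubling and moving terms across avoids division and
  subtraction. \<open>card T \<le> K\<close> keeps the truncated costs exact.\<close>

lemma dim_log_fields_ge:
  assumes "finite T" "card T \<le> K"
  shows "2 * K * (K + 1) + card T * (card T - 1)
    \<le> 2 * bpair.dim (log_fields T K) + 2 * card T * K + 2 * excess line_points T"
  using assms
proof (induction T rule: finite_induct)
  case empty
  then show ?case using dim_log_fields_empty[of K, where 'a='a] by simp
next
  case (insert l T)
  let ?c = "card (\<Union>k\<in>T. line_points l \<inter> line_points k)"
  have "excess line_points (insert l T) = excess line_points T + ?c"
    using insert.hyps by (intro excess_insert) (auto simp: line_points_Int)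
  moreover have "bpair.dim (log_fields T K) \<le> bpair.dim (log_fields (insert l T) K) + (K - (card T - ?c))"
    using insert.hyps by (rule dim_log_fields_insert)
  moreover have "?c \<le> card T"
    unfolding card_crossings[OF insert.hyps(2)] using insert.hyps(1)
    by (intro order_trans[OF card_image_le card_mono]) auto
  then have "K - (card T - ?c) + card T = K + ?c" using insert.prems insert.hyps by simp
  ultimately have "2 * bpair.dim (log_fields T K) + 2 * card T + 2 * excess line_points T
      \<le> 2 * bpair.dim (log_fields (insert l T) K) + 2 * K + 2 * excess line_points (insert l T)"
    by linarith
  moreover have "2 * K * (K + 1) + card T * (card T - 1)
      \<le> 2 * bpair.dim (log_fields T K) + 2 * card T * K + 2 * excess line_points T"
    using insert by simp
  moreover have "Suc (card T) * card T = card T * (card T - 1) + 2 * card T" by (cases "card T") auto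
  ultimately show ?case using insert.hyps by simp
qed


text \<open>For \<open>K > n - e\<close> the lower bound for \<open>dim (log_fields T K)\<close> meets the sum of the upper bounds for the
  dimensions of the top parts, so all these bounds are attained.\<close>

lemma dim_top_parts_eq:
  fixes T :: "('a::field \<times> 'a) set"
  assumes fin: "finite T" and y: "minimal_log_pair (fst ` T) (multiplicity_at T) e y"
    and e: "2 * e \<le> card T" and ex: "excess line_points T \<le> e * (card T - e)" and k: "k \<le> card T"
  shows "upair.dim (top_pair k ` log_fields T (Suc k)) = (Suc k - e) + (Suc k + e - card T)"
proof -
  interpret minimal_log_pair "fst ` T" "multiplicity_at T" e y by (rule y)
  \<comment> \<open>The degrees below \<open>K\<close> then include every
    \<open>k \<le> card T\<close>, in particular \<open>e\<close> and
    \<open>card T - e\<close>.\<close>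
  define K where "K = Suc (card T)"
  define \<tau> where "\<tau> = (\<lambda>k. upair.dim (top_pair k ` log_fields T (Suc k)))"
  define u where "u = (\<lambda>k. (Suc k - e) + (Suc k + e - card T))"
  have "(\<Sum>t\<in>fst ` T. multiplicity_at T t) = card T"
    using sum.image_gen[OF fin, of "\<lambda>_. 1::nat" fst] by simp
  moreover have sub: "top_pair k ` log_fields T (Suc k) \<subseteq> log_pairs (fst ` T) (multiplicity_at T) k" for k
    by (rule image_subsetI) (rule top_pair_in_log_pairs[OF fin])
  moreover have "upair.subspace (top_pair k ` log_fields T (Suc k))" for k
    by (rule bpair_upair.linear_subspace_image[OF linear_top_pair subspace_log_fields])
  ultimately have le: "\<tau> k \<le> u k" for k
    using dim_log_pairs_le[OF sub]
    by (simp add: \<tau>_def u_def)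
  have \<tau>_sum: "bpair.dim (log_fields T j) = (\<Sum>k<j. \<tau> k)" for j
    by (induction j) (auto simp: dim_log_fields_0 dim_log_fields_Suc \<tau>_def)
  have arith: "2 * (\<Sum>k<j. Suc k - a) = (j - a) * (j - a + 1)" for j a :: nat
  proof (induction j)
    case (Suc j)
    then show ?case by (cases "a \<le> j") (auto simp: Suc_diff_le)
  qed simp
  have "2 * (\<Sum>k<K. u k) = 2 * (\<Sum>k<K. Suc k - e) + 2 * (\<Sum>k<K. Suc k - (card T - e))"
  proof -
    have "Suc k + e - card T = Suc k - (card T - e)" for k using e by simp
    then show ?thesis by (simp add: u_def sum.distrib)
  qed
  also have "\<dots> = (K - e) * (K - e + 1) + (K - (card T - e)) * (K - (card T - e) + 1)"
    unfolding arith ..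
  finally have u_sum: "2 * (\<Sum>k<K. u k) = (K - e) * (K - e + 1) + (K - (card T - e)) * (K - (card T - e) + 1)" .
  obtain c where c: "card T = e + c" using e by (metis le_iff_add mult_2 add_leD1)
  \<comment> \<open>This identity singles out \<open>e * (n - e)\<close>: it is the value of the
    excess for which the lower bound equals the sum of the upper bounds.\<close>
  have "2 * (\<Sum>k<K. u k) + 2 * card T * K + 2 * (e * c) = 2 * K * (K + 1) + card T * (card T - 1)"
  proof -
    have "K - e = Suc c" "K - (card T - e) = Suc e" by (auto simp: K_def c)
    moreover have "card T * (card T - 1) + card T = card T * card T" by (cases "card T") auto
    then have "card T * (card T - 1) + (e + c) = (e + c) * (e + c)" by (simp only: c)
    ultimately show ?thesis unfolding u_sum by (simp add: K_def c algebra_simps)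
  qed
  also have "\<dots> \<le> 2 * (\<Sum>k<K. \<tau> k) + 2 * card T * K + 2 * excess line_points T"
    using dim_log_fields_ge[OF fin, of K] by (simp add: \<tau>_sum K_def)
  finally have "(\<Sum>k<K. u k) \<le> (\<Sum>k<K. \<tau> k)" using ex c by simp
  \<comment> \<open>Termwise the bound is \<open>\<tau> \<le> u\<close>, and the sums compare the
    other way, so no degree can be strict.\<close>
  moreover have "(\<Sum>k<K. \<tau> k) < (\<Sum>k<K. u k)" if "\<tau> k < u k"
    by (rule sum_strict_mono_ex1) (use le that k in \<open>auto simp: K_def\<close>)
  ultimately have "\<not> \<tau> k < u k" by linarith
  then show ?thesis using le[of k] by (simp add: \<tau>_def u_def)
qed

text \<open>A column operation: it shows that the determinant vanishes on every line to which both
  fields are tangent.\<close>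

lemma along_pair_det:
  "poly (pair_det x y) q = poly (along l x) q * poly (snd y) q - poly (snd x) q * poly (along l y) q"
  by (simp add: pair_det_def along_def algebra_simps)

text \<open>In degree \<open>e\<close> the attained dimension is positive; in degree
  \<open>n - e\<close> it exceeds by one what multiples of the first leading part can fill. So a
  second field has a leading part not parallel to the first, and the determinant is nonzero of a
  degree that leaves only a constant cofactor.\<close>

theorem ex_log_fields_basis:
  fixes T :: "('a::field \<times> 'a) set"
  assumes fin: "finite T" and y: "minimal_log_pair (fst ` T) (multiplicity_at T) e y"
    and e: "2 * e \<le> card T" and ex: "excess line_points T \<le> e * (card T - e)"
  obtains x\<^sub>1 x\<^sub>2 a where "x\<^sub>1 \<in> log_fields T (Suc e)" "x\<^sub>2 \<in> log_fields T (Suc (card T - e))" "a \<noteq> 0"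
    "pair_det x\<^sub>2 x\<^sub>1 = (\<Prod>l\<in>T. line_eq l) * [:[:a:]:]"
proof -
  let ?n = "card T"
  note dims = dim_top_parts_eq[OF assms]
  have "0 < upair.dim (top_pair e ` log_fields T (Suc e))" using dims[of e] e by simp
  then obtain y1 where "y1 \<in> top_pair e ` log_fields T (Suc e)" "y1 \<noteq> 0"
    by (rule upair.dim_pos_imp_nonzero)
  then obtain x1 where x1: "x1 \<in> log_fields T (Suc e)" "top_pair e x1 \<noteq> 0" by auto
  \<comment> \<open>The leading part of \<open>x1\<close> is itself a nonzero pair of least degree,
    so it can take over the role of \<open>y\<close>.\<close>
  interpret y1: minimal_log_pair "fst ` T" "multiplicity_at T" e "top_pair e x1"
    using y x1 top_pair_in_log_pairs[OF fin x1(1)] unfolding minimal_log_pair_def by auto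
  define W where "W = top_pair (?n - e) ` log_fields T (Suc (?n - e))"
  have W: "W \<subseteq> log_pairs (fst ` T) (multiplicity_at T) (?n - e)"
    using top_pair_in_log_pairs[OF fin] by (auto simp: W_def)
  have "upair.dim {x \<in> W. pair_det x (top_pair e x1) = 0} < upair.dim W"
    using y1.dim_parallel_le[OF W] dims[of "?n - e"] e by (simp add: W_def)
  then have "{x \<in> W. pair_det x (top_pair e x1) = 0} \<noteq> W" by auto
  then obtain y2 where "y2 \<in> W" "pair_det y2 (top_pair e x1) \<noteq> 0" by auto
  then obtain x2 where x2: "x2 \<in> log_fields T (Suc (?n - e))"
    "pair_det (top_pair (?n - e) x2) (top_pair e x1) \<noteq> 0"
    unfolding W_def by (elim imageE) simp
  let ?d = "pair_det x2 x1"
  have mem: "fst x1 \<in> tdeg_below (Suc e)" "snd x1 \<in> tdeg_below (Suc e)"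
    "fst x2 \<in> tdeg_below (Suc (?n - e))" "snd x2 \<in> tdeg_below (Suc (?n - e))"
    using x1 x2 by (auto simp: log_fields_def)
  have ne: "?n - e + e = ?n" using e by simp
  have d: "?d \<in> tdeg_below (Suc ?n)"
    using mem ne mult_in_tdeg_below[OF mem(3,2)] mult_in_tdeg_below[OF mem(4,1)]
    by (auto simp: pair_det_def intro!: tdeg_below_closed)
  have "top_part ?n ?d = pair_det (top_pair (?n - e) x2) (top_pair e x1)"
    using top_part_mult[OF mem(3,2)] top_part_mult[OF mem(4,1)] ne
    by (simp add: pair_det_def top_part_diff top_pair_def)
  then have nz: "?d \<noteq> 0" using x2(2) by (auto simp: top_part_def const_poly.homogenize_zero)
  have "poly ?d (line_poly l) = 0" if "l \<in> T" for l
    using that x1 x2 by (simp add: along_pair_det[of _ _ _ l] log_fields_def)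
  then obtain H where H: "H \<in> tdeg_below (Suc ?n - ?n)" "?d = (\<Prod>l\<in>T. line_eq l) * H"
    using prod_line_eq_quotient[OF fin d] by blast
  define a where "a = coeff (coeff H 0) 0"
  have "H = [:[:a:]:]"
  proof (intro poly_eqI)
    fix i j
    show "coeff (coeff H i) j = coeff (coeff [:[:a:]:] i) j"
      using H(1) by (cases i; cases j) (auto simp: a_def tdeg_below_def)
  qed
  moreover have "a \<noteq> 0" using nz H(2) \<open>H = [:[:a:]:]\<close> by auto
  ultimately show thesis using that x1(1) x2(1) H(2) by blast
qed

section \<open>Polynomials in three variables\<close>

lemma const3_add: "const3 (a + b) = const3 a + const3 b"
  by (simp add: const3_def single_add)

lemma const3_mult: "const3 (a * b) = const3 a * const3 b"
  by (simp add: const3_def mult_single)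

lemma const3_one: "const3 1 = 1"
  by (simp add: const3_def)

interpretation const3: coefficient_hom "const3 :: 'a::field \<Rightarrow> _"
  by unfold_locales (simp_all add: const3_add const3_mult const3_one)

lemma const3_eq_0_iff: "const3 c = 0 \<longleftrightarrow> c = 0"
  by (metis const3_def const3.hom_zero lookup_single_eq lookup_zero)

lemma var3_power: "var3 i ^ n = Poly_Mapping.single (Poly_Mapping.single i n) (1 :: 'a::field)"
proof (induction n)
  case (Suc n)
  have "Poly_Mapping.single i 1 + Poly_Mapping.single i n = Poly_Mapping.single i (Suc n)"
    by (simp flip: single_add)
  then show ?case using Suc by (simp add: var3_def mult_single)
qed simp

lemma prod_single_one:
  "finite F \<Longrightarrow> (\<Prod>i\<in>F. Poly_Mapping.single (m i) 1) = Poly_Mapping.single (\<Sum>i\<in>F. m i) (1 :: 'a::field)"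
  for m :: "'i \<Rightarrow> 3 \<Rightarrow>\<^sub>0 nat"
  by (induction F rule: finite_induct) (simp_all add: mult_single)

lemma sum_single_lookup: "(\<Sum>i\<in>UNIV. Poly_Mapping.single i (Poly_Mapping.lookup m i)) = m"
  for m :: "'i::finite \<Rightarrow>\<^sub>0 nat"
  by (rule poly_mapping_eqI) (simp add: lookup_sum lookup_single when_def)

lemma single_eq_monomial:
  "Poly_Mapping.single m a = const3 a * (\<Prod>i\<in>UNIV. var3 i ^ Poly_Mapping.lookup m i)"
  by (simp add: var3_power prod_single_one sum_single_lookup const3_def mult_single)

lemma poly3_eq_sum_single: "(\<Sum>m\<in>Poly_Mapping.keys f. Poly_Mapping.single m (Poly_Mapping.lookup f m)) = f"
  for f :: "'a::field poly3"
  by (rule poly_mapping_eqI) (simp add: lookup_sum lookup_single when_def in_keys_iff)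

text \<open>Constants and variables generate the ring, so identities between homomorphisms or
  derivations need only be checked on them.\<close>

lemma poly3_induct [case_names const var add mult]:
  fixes f :: "'a::field poly3"
  assumes const: "\<And>c. P (const3 c)" and var: "\<And>i. P (var3 i)"
    and add: "\<And>f g. P f \<Longrightarrow> P g \<Longrightarrow> P (f + g)" and mult: "\<And>f g. P f \<Longrightarrow> P g \<Longrightarrow> P (f * g)"
  shows "P f"
proof -
  have one: "P 1" using const[of 1] by (simp add: const3_one)
  have pow: "P (var3 i ^ n)" for i n
    by (induction n) (auto simp: one intro: var mult)
  have "P (\<Prod>i\<in>F. var3 i ^ k i)" for F :: "3 set" and k
    by (induction F rule: infinite_finite_induct) (auto simp: one intro: pow mult)
  then have single: "P (Poly_Mapping.single m a)" for m a
    unfolding single_eq_monomial by (intro mult const)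
  have "P (\<Sum>m\<in>M. Poly_Mapping.single m (c m))" for M :: "(3 \<Rightarrow>\<^sub>0 nat) set" and c
    using const[of 0] by (induction M rule: infinite_finite_induct) (auto simp: const3.hom_zero intro: single add)
  then show ?thesis using poly3_eq_sum_single[of f] by metis
qed

text \<open>The universal property of the polynomial ring. Values in the ring itself serve to
  eliminate a variable; values in polynomials over it produce derivations.\<close>

definition eval3 :: "('a::field \<Rightarrow> 'r::comm_ring_1) \<Rightarrow> (3 \<Rightarrow> 'r) \<Rightarrow> 'a poly3 \<Rightarrow> 'r" where
  "eval3 c v f = (\<Sum>m\<in>Poly_Mapping.keys f. c (Poly_Mapping.lookup f m) * (\<Prod>i\<in>UNIV. v i ^ Poly_Mapping.lookup m i))"

locale field_coefficient_hom = coefficient_hom c for c :: "'a::field \<Rightarrow> 'r::comm_ring_1"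
begin

lemma eval3_superset:
  assumes "finite M" "Poly_Mapping.keys f \<subseteq> M"
  shows "eval3 c v f = (\<Sum>m\<in>M. c (Poly_Mapping.lookup f m) * (\<Prod>i\<in>UNIV. v i ^ Poly_Mapping.lookup m i))"
  unfolding eval3_def
  by (rule sum.mono_neutral_left[OF assms]) (auto simp: in_keys_iff hom_zero)

lemma eval3_add: "eval3 c v (f + g) = eval3 c v f + eval3 c v g"
proof -
  let ?M = "Poly_Mapping.keys f \<union> Poly_Mapping.keys g"
  have "finite ?M" "Poly_Mapping.keys (f + g) \<subseteq> ?M" by (simp_all add: Poly_Mapping.keys_add)
  then show ?thesis
    by (simp add: eval3_superset[of ?M] lookup_add hom_add distrib_right sum.distrib)
qed

lemma eval3_zero: "eval3 c v 0 = 0"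
  by (simp add: eval3_def)

lemma eval3_sum: "eval3 c v (\<Sum>i\<in>I. f i) = (\<Sum>i\<in>I. eval3 c v (f i))"
  by (induction I rule: infinite_finite_induct) (auto simp: eval3_add eval3_zero)

lemma eval3_single:
  "eval3 c v (Poly_Mapping.single m a) = c a * (\<Prod>i\<in>UNIV. v i ^ Poly_Mapping.lookup m i)"
  by (subst eval3_superset[of "{m}"]) auto

lemma eval3_mult: "eval3 c v (f * g) = eval3 c v f * eval3 c v g"
proof -
  have "f * g = (\<Sum>m\<in>Poly_Mapping.keys f. Poly_Mapping.single m (Poly_Mapping.lookup f m)) *
      (\<Sum>m\<in>Poly_Mapping.keys g. Poly_Mapping.single m (Poly_Mapping.lookup g m))"
    by (simp only: poly3_eq_sum_single)
  then have "eval3 c v (f * g) = (\<Sum>m\<in>Poly_Mapping.keys f. \<Sum>n\<in>Poly_Mapping.keys g.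
      eval3 c v (Poly_Mapping.single (m + n) (Poly_Mapping.lookup f m * Poly_Mapping.lookup g n)))"
    by (simp only: sum_product mult_single eval3_sum)
  also have "\<dots> = eval3 c v f * eval3 c v g"
    unfolding eval3_def[of c v f] eval3_def[of c v g] sum_product eval3_single
    by (simp add: hom_mult lookup_add power_add prod.distrib mult_ac)
  finally show ?thesis .
qed

lemma eval3_const3: "eval3 c v (const3 a) = c a"
  by (simp add: const3_def eval3_single)

lemma eval3_var3: "eval3 c v (var3 i) = v i"
proof -
  have "(\<Prod>j\<in>UNIV. v j ^ Poly_Mapping.lookup (Poly_Mapping.single i 1) j) = (\<Prod>j\<in>UNIV. if j = i then v i else 1)"
    by (intro prod.cong) (auto simp: lookup_single)
  then show ?thesis by (simp add: var3_def eval3_single hom_one)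
qed

lemma eval3_linear_form: "eval3 c v (linear_form a) = (\<Sum>i\<in>UNIV. c (a $ i) * v i)"
  by (simp add: linear_form_def eval3_sum eval3_mult eval3_const3 eval3_var3)

end

interpretation const3: field_coefficient_hom "const3 :: 'a::field \<Rightarrow> _"
  by unfold_locales

interpretation dual3: field_coefficient_hom "\<lambda>a :: 'a::field. [:const3 a:]"
  by unfold_locales (auto simp: const3_add const3_mult const3_one one_pCons mult.commute)

lemma dvd_diff_eval3:
  assumes "\<And>i. p dvd var3 i - v i"
  shows "p dvd f - eval3 const3 v f"
proof (induction f rule: poly3_induct)
  case (add f g)
  have "f + g - eval3 const3 v (f + g) = (f - eval3 const3 v f) + (g - eval3 const3 v g)"
    by (simp add: const3.eval3_add)
  then show ?case using dvd_add[OF add] by (simp only:)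
next
  case (mult f g)
  have "f * g - eval3 const3 v (f * g) = f * (g - eval3 const3 v g) + (f - eval3 const3 v f) * eval3 const3 v g"
    by (simp add: const3.eval3_mult algebra_simps)
  then show ?case using mult by (simp only: dvd_add dvd_mult dvd_mult2)
qed (simp_all add: assms const3.eval3_const3 const3.eval3_var3)

lemma derivation3_const: "derivation3 \<theta> \<Longrightarrow> \<theta> (const3 c) = 0"
proof -
  assume \<theta>: "derivation3 \<theta>"
  then have "\<theta> (1 * 1) = 1 * \<theta> 1 + 1 * \<theta> 1" unfolding derivation3_def by blast
  then have "\<theta> 1 + \<theta> 1 = \<theta> 1 + 0" by (simp only: mult_1_left add_0_right)
  then have "\<theta> 1 = 0" by (simp only: add_left_cancel)
  moreover have "\<theta> (const3 c * 1) = const3 c * \<theta> 1" using \<theta> unfolding derivation3_def by blast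
  ultimately show ?thesis by simp
qed

lemma derivation3_eqI:
  assumes "derivation3 \<theta>" "derivation3 \<eta>" "\<And>i. \<theta> (var3 i) = \<eta> (var3 i)"
  shows "\<theta> = \<eta>"
proof
  fix f
  show "\<theta> f = \<eta> f"
  proof (induction f rule: poly3_induct)
    case (add f g)
    then show ?case using assms(1,2) by (simp add: derivation3_def)
  next
    case (mult f g)
    then show ?case using assms(1,2) by (simp add: derivation3_def)
  qed (simp_all add: assms derivation3_const)
qed

text \<open>A derivation is the coefficient of the infinitesimal in a homomorphism to dual numbers.\<close>

definition derivation_of :: "(3 \<Rightarrow> 'a::field poly3) \<Rightarrow> 'a poly3 \<Rightarrow> 'a poly3" where
  "derivation_of g f = coeff (eval3 (\<lambda>a. [:const3 a:]) (\<lambda>i. [:var3 i, g i:]) f) 1"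

text \<open>Polynomials in the infinitesimal stand in for dual numbers: coefficients 0 and 1 of a
  product depend only on coefficients 0 and 1 of the factors.\<close>

lemma coeff_0_dual: "coeff (eval3 (\<lambda>a. [:const3 a:]) (\<lambda>i. [:var3 i, g i:]) f) 0 = f"
  by (induction f rule: poly3_induct)
     (simp_all add: dual3.eval3_const3 dual3.eval3_var3 dual3.eval3_add dual3.eval3_mult coeff_mult)

lemma derivation3_derivation_of: "derivation3 (derivation_of g)"
  unfolding derivation3_def derivation_of_def
  by (simp add: dual3.eval3_add dual3.eval3_mult dual3.eval3_const3 coeff_mult coeff_0_dual[simplified])

lemma derivation_of_var3: "derivation_of g (var3 i) = g i"
  by (simp add: derivation_of_def dual3.eval3_var3)

lemma derivation3_linear_form:
  assumes "derivation3 \<theta>"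
  shows "\<theta> (linear_form a) = (\<Sum>i\<in>UNIV. const3 (a $ i) * \<theta> (var3 i))"
proof -
  have "\<theta> (\<Sum>i\<in>F. const3 (a $ i) * var3 i) = (\<Sum>i\<in>F. const3 (a $ i) * \<theta> (var3 i))" for F
  proof -
    have "\<theta> (f + g) = \<theta> f + \<theta> g" "\<theta> (const3 c * f) = const3 c * \<theta> f" "\<theta> 0 = 0" for c f g
      using assms derivation3_const[OF assms, of 0] unfolding derivation3_def const3.hom_zero by blast+
    then show ?thesis by (induction F rule: infinite_finite_induct) simp_all
  qed
  then show ?thesis by (simp add: linear_form_def)
qed

section \<open>Linear forms as prime elements\<close>

lemma lookup_linear_form:
  "Poly_Mapping.lookup (linear_form a) (Poly_Mapping.single i 1) = a $ i"
proof -
  have "Poly_Mapping.single j 1 = (Poly_Mapping.single i 1 :: 3 \<Rightarrow>\<^sub>0 nat) \<longleftrightarrow> j = i" for j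
    by (metis lookup_single_eq lookup_single_not_eq one_neq_zero)
  then show ?thesis
    by (simp add: linear_form_def lookup_sum const3_def var3_def mult_single lookup_single when_def)
qed

lemma linear_form_eq_0_iff: "linear_form a = 0 \<longleftrightarrow> a = 0"
proof
  assume "linear_form a = 0"
  then show "a = 0" using lookup_linear_form[of a] by (simp add: vec_eq_iff)
qed (simp add: linear_form_def const3.hom_zero)

lemma linear_form_diff: "linear_form (a - b) = linear_form a - linear_form b"
  by (simp add: linear_form_def const3.hom_diff left_diff_distrib sum_subtractf)

lemma linear_form_scale: "linear_form (s *s a) = const3 s * linear_form a"
  by (simp add: linear_form_def const3_mult sum_distrib_left mult.assoc)

text \<open>The quotient by the ideal of the form \<open>a\<close>, realized as an endomorphism:
  where \<open>a $ i\<close> is nonzero, variable \<open>i\<close> is replaced by its solution of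
  the equation of \<open>a\<close>.\<close>

definition eliminate :: "'a::field ^ 3 \<Rightarrow> 3 \<Rightarrow> 'a poly3 \<Rightarrow> 'a poly3" where
  "eliminate a i = eval3 const3 (\<lambda>j. var3 j - (if j = i then const3 (1 / a $ i) * linear_form a else 0))"

lemma eliminate_linear_form:
  "eliminate a i (linear_form b) = linear_form (b - (b $ i / a $ i) *s a)"
proof -
  let ?q = "const3 (1 / a $ i) * linear_form a"
  have "eliminate a i (linear_form b) =
      (\<Sum>j\<in>UNIV. const3 (b $ j) * var3 j - (if j = i then const3 (b $ i) * ?q else 0))"
    unfolding eliminate_def const3.eval3_linear_form
    by (intro sum.cong) (auto simp: right_diff_distrib)
  also have "\<dots> = linear_form b - const3 (b $ i) * ?q"
    by (simp add: sum_subtractf linear_form_def[of b])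
  finally show ?thesis
    by (simp add: linear_form_diff linear_form_scale flip: mult.assoc const3_mult)
qed

lemma linear_form_dvd_iff_eliminate:
  assumes "a $ i \<noteq> 0"
  shows "linear_form a dvd f \<longleftrightarrow> eliminate a i f = 0"
proof
  have "eliminate a i (linear_form a) = 0"
    using assms by (simp add: eliminate_linear_form linear_form_eq_0_iff)
  moreover assume "linear_form a dvd f"
  ultimately show "eliminate a i f = 0"
    unfolding eliminate_def by (auto elim!: dvdE simp: const3.eval3_mult)
next
  assume "eliminate a i f = 0"
  moreover have "linear_form a dvd f - eliminate a i f"
    unfolding eliminate_def by (rule dvd_diff_eval3) auto
  ultimately show "linear_form a dvd f" by simp
qed

text \<open>The kernel of a homomorphism into an integral domain is prime.\<close>

lemma linear_form_dvd_multD: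
  assumes "a \<noteq> 0" "linear_form a dvd f * g"
  shows "linear_form a dvd f \<or> linear_form a dvd g"
proof -
  obtain i where i: "a $ i \<noteq> 0" using assms(1) by (auto simp: vec_eq_iff)
  show ?thesis
    using assms(2) unfolding linear_form_dvd_iff_eliminate[OF i]
    by (simp add: eliminate_def const3.eval3_mult)
qed

lemma linear_form_dvd_linear_formD:
  assumes "a \<noteq> 0" "linear_form a dvd linear_form b"
  shows "\<exists>s. b = s *s a"
proof -
  obtain i where i: "a $ i \<noteq> 0" using assms(1) by (auto simp: vec_eq_iff)
  have "b - (b $ i / a $ i) *s a = 0"
    using assms(2) unfolding linear_form_dvd_iff_eliminate[OF i] eliminate_linear_form linear_form_eq_0_iff .
  then show ?thesis by auto
qed

text \<open>Forms that are pairwise not proportional are non-associated primes, so each further one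
  divides the cofactor.\<close>

lemma prod_linear_forms_dvd:
  assumes "finite I" "\<And>i. i \<in> I \<Longrightarrow> v i \<noteq> 0" "\<And>i. i \<in> I \<Longrightarrow> linear_form (v i) dvd f"
    and "\<And>i j s. i \<in> I \<Longrightarrow> j \<in> I \<Longrightarrow> i \<noteq> j \<Longrightarrow> v j \<noteq> s *s v i"
  shows "(\<Prod>i\<in>I. linear_form (v i)) dvd f"
  using assms
proof (induction I rule: finite_induct)
  case (insert i I)
  then obtain g where g: "f = (\<Prod>i\<in>I. linear_form (v i)) * g" by (auto elim: dvdE)
  have "\<not> linear_form (v i) dvd (\<Prod>j\<in>J. linear_form (v j))" if "finite J" "J \<subseteq> I" for J
    using that
  proof (induction J rule: finite_induct)
    case empty
    have "\<not> linear_form (v i) dvd 1"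
    proof -
      obtain k where k: "v i $ k \<noteq> 0" using insert.prems(1)[of i] by (auto simp: vec_eq_iff)
      have "eliminate (v i) k 1 = 1"
        using const3.eval3_const3[of _ 1] by (simp add: eliminate_def const3_one)
      then show ?thesis unfolding linear_form_dvd_iff_eliminate[OF k] by simp
    qed
    then show ?case by simp
  next
    case (insert j J)
    have "\<not> linear_form (v i) dvd linear_form (v j)"
      using linear_form_dvd_linear_formD[of "v i" "v j"] insert insert.prems \<open>i \<notin> I\<close>
        \<open>\<And>i' j s. i' \<in> insert i I \<Longrightarrow> j \<in> insert i I \<Longrightarrow> i' \<noteq> j \<Longrightarrow> v j \<noteq> s *s v i'\<close>
        \<open>\<And>i'. i' \<in> insert i I \<Longrightarrow> v i' \<noteq> 0\<close>
      by blast
    then show ?case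
      using insert linear_form_dvd_multD[of "v i"] \<open>\<And>i'. i' \<in> insert i I \<Longrightarrow> v i' \<noteq> 0\<close> by auto
  qed
  then have "linear_form (v i) dvd g"
    using linear_form_dvd_multD[of "v i" _ g] insert.prems(1,2)[of i] insert.hyps(1) unfolding g by blast
  then show ?case using insert.hyps g by (simp add: mult_dvd_mono mult.commute)
qed simp

section \<open>Freeness of the cone\<close>

lemma hyperplane_eq_imp_scale:
  fixes a b :: "'a::field ^ 'n"
  assumes "{x. scalar_product a x = 0} = {x. scalar_product b x = 0}" "a \<noteq> 0" "b \<noteq> 0"
  shows "\<exists>s. s \<noteq> 0 \<and> a = s *s b"
proof -
  obtain i where i: "b $ i \<noteq> 0" using assms(3) by (auto simp: vec_eq_iff)
  have sp: "scalar_product v (axis j c - axis k d) = v $ j * c - v $ k * d" for v :: "'a ^ 'n" and j k c d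
  proof -
    have "(\<Sum>i\<in>UNIV. v $ i * axis j c $ i) = v $ j * c" for j c
      by (simp add: axis_def if_distrib[of "(*) _"] cong: if_cong)
    then show ?thesis by (simp add: scalar_product_def right_diff_distrib sum_subtractf)
  qed
  have "a $ j = (a $ i / b $ i) * b $ j" for j
  proof -
    \<comment> \<open>These vectors lie in the kernel of \<open>b\<close>; testing \<open>a\<close>
      on them gives the proportionality coordinate by coordinate.\<close>
    have "axis j (b $ i) - axis i (b $ j) \<in> {x. scalar_product b x = 0}"
      by (simp add: sp mult.commute)
    then have "scalar_product a (axis j (b $ i) - axis i (b $ j)) = 0" using assms(1) by blast
    then show ?thesis using i by (simp add: sp field_simps)
  qed
  then have "a = (a $ i / b $ i) *s b"
    unfolding vec_eq_iff vector_smult_component by blast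
  moreover from this have "a $ i / b $ i \<noteq> 0" using assms(2) by auto
  ultimately show ?thesis by blast
qed

lemma mem_log_derivations_iff:
  assumes "\<And>v. v \<in> N \<Longrightarrow> v \<noteq> 0"
  shows "\<theta> \<in> log_derivations ((\<lambda>v. {x. scalar_product v x = 0}) ` N) \<longleftrightarrow>
    derivation3 \<theta> \<and> (\<forall>v\<in>N. linear_form v dvd \<theta> (linear_form v))"
proof (intro iffI conjI ballI)
  assume R: "derivation3 \<theta> \<and> (\<forall>v\<in>N. linear_form v dvd \<theta> (linear_form v))"
  have "linear_form a dvd \<theta> (linear_form a)"
    if a: "a \<noteq> 0" and v: "v \<in> N" "{x. scalar_product a x = 0} = {x. scalar_product v x = 0}" for a v
  proof -
    obtain s where s: "a = s *s v" using hyperplane_eq_imp_scale[OF v(2) a assms[OF v(1)]] by auto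
    have "\<theta> (const3 s * linear_form v) = const3 s * \<theta> (linear_form v)"
      using R unfolding derivation3_def by blast
    then show ?thesis using R v(1) by (auto simp: s linear_form_scale mult_dvd_mono)
  qed
  then show "\<theta> \<in> log_derivations ((\<lambda>v. {x. scalar_product v x = 0}) ` N)"
    using R by (auto simp: log_derivations_def)
next
  fix v assume "\<theta> \<in> log_derivations ((\<lambda>v. {x. scalar_product v x = 0}) ` N)" "v \<in> N"
  then show "linear_form v dvd \<theta> (linear_form v)"
    using assms unfolding log_derivations_def by blast
qed (simp add: log_derivations_def)

lemma subspace_log_derivations: "der.subspace (log_derivations B)"
proof -
  have "derivation3 0" by (simp add: derivation3_def)
  moreover have "derivation3 (\<theta> + \<eta>)" if "derivation3 \<theta>" "derivation3 \<eta>" for \<theta> \<eta> :: "'a poly3 \<Rightarrow> 'a poly3"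
    using derivation3_const[OF that(1)] derivation3_const[OF that(2)] that
    unfolding derivation3_def by (simp add: algebra_simps)
  moreover have "derivation3 (der_scale s \<theta>)" if "derivation3 \<theta>" for s and \<theta> :: "'a poly3 \<Rightarrow> 'a poly3"
    using derivation3_const[OF that] that unfolding derivation3_def der_scale_def by (simp add: algebra_simps)
  ultimately show ?thesis
    by (auto simp: der.subspace_def log_derivations_def der_scale_def intro!: dvd_add dvd_mult)
qed

text \<open>The equation of the cone over \<open>x = t * y + c\<close>, where \<open>x\<close> and \<open>y\<close> are the sheared coordinates
  \<open>x\<^sub>1\<close> and \<open>x\<^sub>2 - s * x\<^sub>1\<close>.\<close>

definition cone_normal :: "'a::field \<Rightarrow> 'a \<times> 'a \<Rightarrow> 'a ^ 3" where
  "cone_normal s l = vector [1 + fst l * s, - fst l, - snd l]"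

lemma cone_normal_nz: "cone_normal s l \<noteq> 0"
proof
  assume "cone_normal s l = 0"
  then have "cone_normal s l $ 1 = 0" "cone_normal s l $ 2 = 0" by simp_all
  then show False by (simp add: cone_normal_def)
qed

text \<open>The first entry plus \<open>s\<close> times the second is always 1, which forces the
  scalar to be 1.\<close>

lemma cone_normal_parallel:
  assumes "cone_normal s l = r *s cone_normal s k"
  shows "l = k"
proof -
  have "cone_normal s l $ i = r * cone_normal s k $ i" for i using assms by simp
  from this[of 1] this[of 2] this[of 3]
  have *: "1 + fst l * s = r * (1 + fst k * s)" "fst l = r * fst k" "snd l = r * snd k"
    by (simp_all add: cone_normal_def)
  have "1 + fst l * s = r + fst l * s" using *(1) unfolding *(2) by (simp add: algebra_simps)
  then have "r = 1" by simp
  then show ?thesis using * by (simp add: prod_eq_iff)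
qed

lemma cone_normal_not_infinite: "cone_normal s l \<noteq> r *s axis 3 1"
proof
  assume "cone_normal s l = r *s axis 3 1"
  then have "cone_normal s l $ i = r * axis 3 1 $ i" for i by simp
  from this[of 1] this[of 2] show False by (simp add: cone_normal_def axis_def)
qed

section \<open>Homogenized fields as derivations, and Saito's criterion\<close>

context
  fixes s :: "'a::field"
begin

abbreviation "shear_y \<equiv> var3 2 - const3 s * var3 1"

abbreviation "hom3 \<equiv> homogenize const3 (var3 1) shear_y (var3 3)"

lemma linear_form_cone_normal:
  "linear_form (cone_normal s l) = var3 1 - const3 (fst l) * shear_y - const3 (snd l) * var3 3"
  by (simp add: linear_form_def sum_3 cone_normal_def const3.hom_add const3.hom_uminus const3.hom_mult
      const3_one algebra_simps)

lemma hom3_line_dvd: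
  assumes "x \<in> log_fields T (Suc k)" "l \<in> T"
  shows "linear_form (cone_normal s l) dvd hom3 k (fst x) - const3 (fst l) * hom3 k (snd x)"
proof -
  have "hom3 k (fst x) - const3 (fst l) * hom3 k (snd x) = hom3 k (along l x)"
    by (simp add: along_def const3.homogenize_diff const3.homogenize_smult)
  moreover obtain H where H: "H \<in> tdeg_below k" "along l x = line_eq l * H"
    using prod_line_eq_quotient[of "{l}" "along l x" "Suc k"] assms along_in_tdeg_below[OF assms(1)]
    by (auto simp: log_fields_def)
  have "linear_form (cone_normal s l) dvd hom3 k (line_eq l * H)"
  proof (cases k)
    case 0
    then have "H = 0" using H(1) by (auto simp: tdeg_below_def poly_eq_iff)
    then show ?thesis by (simp add: const3.homogenize_zero)
  next
    case (Suc j)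
    then show ?thesis
      using const3.homogenize_mult[OF line_eq_in_tdeg_below, of H j "var3 1" shear_y "var3 3" l] H(1)
        const3.homogenize_line_eq[of "var3 1" shear_y "var3 3" l]
      by (simp add: linear_form_cone_normal)
  qed
  ultimately show ?thesis by (simp add: H(2))
qed

text \<open>The value at \<open>var3 2\<close> undoes the shear, so that \<open>shear_y\<close> is
  sent to the homogenized second component.\<close>

definition hom_derivation :: "nat \<Rightarrow> 'a poly poly \<times> 'a poly poly \<Rightarrow> 'a poly3 \<Rightarrow> 'a poly3" where
  "hom_derivation k x = derivation_of
     (\<lambda>i. if i = 1 then hom3 k (fst x) else if i = 2 then hom3 k (snd x) + const3 s * hom3 k (fst x) else 0)"

lemma derivation3_shear_y:
  assumes "derivation3 \<theta>"
  shows "\<theta> shear_y = \<theta> (var3 2) - const3 s * \<theta> (var3 1)"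
proof -
  have "\<theta> (shear_y + const3 s * var3 1) = \<theta> shear_y + \<theta> (const3 s * var3 1)"
    "\<theta> (const3 s * var3 1) = const3 s * \<theta> (var3 1)"
    using assms unfolding derivation3_def by blast+
  then show ?thesis by simp
qed

lemma derivation3_cone_normal:
  assumes "derivation3 \<theta>"
  shows "\<theta> (linear_form (cone_normal s l)) =
    \<theta> (var3 1) - const3 (fst l) * \<theta> shear_y - const3 (snd l) * \<theta> (var3 3)"
  by (simp add: derivation3_linear_form[OF assms] derivation3_shear_y[OF assms] sum_3 cone_normal_def
      const3.hom_add const3.hom_uminus const3.hom_mult const3_one algebra_simps)

lemma hom_derivation:
  "derivation3 (hom_derivation k x)" "hom_derivation k x (var3 1) = hom3 k (fst x)"
  "hom_derivation k x shear_y = hom3 k (snd x)" "hom_derivation k x (var3 3) = 0"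
proof -
  show der: "derivation3 (hom_derivation k x)"
    unfolding hom_derivation_def by (rule derivation3_derivation_of)
  show "hom_derivation k x (var3 1) = hom3 k (fst x)" "hom_derivation k x (var3 3) = 0"
    by (simp_all add: hom_derivation_def derivation_of_var3)
  show "hom_derivation k x shear_y = hom3 k (snd x)"
    unfolding derivation3_shear_y[OF der] by (simp add: hom_derivation_def derivation_of_var3)
qed

definition euler :: "'a poly3 \<Rightarrow> 'a poly3" where
  "euler = derivation_of var3"

lemma euler:
  "derivation3 euler" "euler (var3 i) = var3 i" "euler shear_y = shear_y"
  using derivation3_shear_y[of euler]
  by (simp_all add: euler_def derivation3_derivation_of derivation_of_var3)

lemma derivation3_eqI_shear:
  assumes "derivation3 \<theta>" "derivation3 \<eta>" "\<theta> (var3 1) = \<eta> (var3 1)" "\<theta> shear_y = \<eta> shear_y"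
    "\<theta> (var3 3) = \<eta> (var3 3)"
  shows "\<theta> = \<eta>"
proof (rule derivation3_eqI[OF assms(1,2)])
  have "\<theta> (var3 2) = \<eta> (var3 2)"
    using assms by (simp add: derivation3_shear_y)
  then show "\<theta> (var3 i) = \<eta> (var3 i)" for i
    using assms exhaust_3[of i] by auto
qed

text \<open>Saito's criterion: \<open>euler\<close> and the homogenizations of \<open>x\<close> and \<open>y\<close> have the defining polynomial
  of the cone as determinant, so coefficients with respect to them are found by Cramer's rule.\<close>

theorem free_cone:
  assumes fin: "finite T" and x: "x \<in> log_fields T (Suc i)" and y: "y \<in> log_fields T (Suc j)"
    and deg: "i + j = card T"
    and det: "pair_det y x = (\<Prod>l\<in>T. line_eq l) * [:[:a:]:]" and a: "a \<noteq> 0"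
  shows "free_arrangement ((\<lambda>v. {x. scalar_product v x = 0}) ` insert (axis 3 1) (cone_normal s ` T))"
proof -
  define B where "B = (\<lambda>v. {x. scalar_product v x = 0}) ` insert (axis 3 1) (cone_normal s ` T)"
  let ?\<alpha> = "\<lambda>l. linear_form (cone_normal s l)"
  define F where "F = hom3 i (fst x)"
  define G where "G = hom3 i (snd x)"
  define P where "P = hom3 j (fst y)"
  define Q where "Q = hom3 j (snd y)"
  define \<Delta> where "\<Delta> = P * G - Q * F"
  define \<theta> where "\<theta> = hom_derivation i x"
  define \<eta> where "\<eta> = hom_derivation j y"
  have mem: "fst x \<in> tdeg_below (Suc i)" "snd x \<in> tdeg_below (Suc i)"
    "fst y \<in> tdeg_below (Suc j)" "snd y \<in> tdeg_below (Suc j)"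
    using x y by (auto simp: log_fields_def)
  have "\<Delta> = hom3 (card T) (pair_det y x)"
    unfolding \<Delta>_def P_def Q_def F_def G_def pair_det_def const3.homogenize_diff
    using const3.homogenize_mult[OF mem(3,2)] const3.homogenize_mult[OF mem(4,1)] deg by (simp add: add.commute)
  also have "pair_det y x = smult [:a:] (\<Prod>l\<in>T. line_eq l)" by (simp add: det)
  also have "hom3 (card T) \<dots> = const3 a * (\<Prod>l\<in>T. ?\<alpha> l)"
    by (simp add: const3.homogenize_smult const3.homogenize_prod_line_eq(2)[OF fin] linear_form_cone_normal)
  finally have \<Delta>: "\<Delta> = const3 a * (\<Prod>l\<in>T. ?\<alpha> l)" .
  have "?\<alpha> l \<noteq> 0" for l by (simp add: linear_form_eq_0_iff cone_normal_nz)
  then have \<Delta>_nz: "\<Delta> \<noteq> 0" using fin a by (simp add: \<Delta> const3_eq_0_iff)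
  have \<Delta>_dvd: "\<Delta> dvd f" if "\<And>l. l \<in> T \<Longrightarrow> ?\<alpha> l dvd f" for f
  proof -
    have "(\<Prod>l\<in>T. ?\<alpha> l) dvd f"
      by (rule prod_linear_forms_dvd[OF fin cone_normal_nz that]) (auto dest: cone_normal_parallel)
    then obtain g where "f = (\<Prod>l\<in>T. ?\<alpha> l) * g" by (auto elim: dvdE)
    then have "f = \<Delta> * (const3 (1 / a) * g)"
      using a by (simp add: \<Delta> mult_ac flip: const3_one) (simp add: const3_one flip: mult.assoc const3_mult)
    then show ?thesis by simp
  qed
  have Z: "linear_form (axis 3 1) = (var3 3 :: 'a poly3)"
    by (simp add: linear_form_def sum_3 axis_def const3.hom_zero const3_one)
  have nz: "v \<noteq> 0" if "v \<in> insert (axis 3 1) (cone_normal s ` T)" for v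
    using that by (elim insertE imageE) (simp_all add: axis_eq_0_iff cone_normal_nz)
  have D: "\<psi> \<in> log_derivations B \<longleftrightarrow>
      derivation3 \<psi> \<and> var3 3 dvd \<psi> (var3 3) \<and> (\<forall>l\<in>T. ?\<alpha> l dvd \<psi> (?\<alpha> l))" for \<psi>
    unfolding B_def by (subst mem_log_derivations_iff[OF nz]) (assumption, simp add: Z)
  have \<theta>: "derivation3 \<theta>" "\<theta> (var3 1) = F" "\<theta> shear_y = G" "\<theta> (var3 3) = 0"
    and \<eta>: "derivation3 \<eta>" "\<eta> (var3 1) = P" "\<eta> shear_y = Q" "\<eta> (var3 3) = 0"
    by (simp_all add: \<theta>_def \<eta>_def F_def G_def P_def Q_def hom_derivation)
  have F: "?\<alpha> l dvd F - const3 (fst l) * G" and P: "?\<alpha> l dvd P - const3 (fst l) * Q" if "l \<in> T" for l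
    using hom3_line_dvd[OF x that] hom3_line_dvd[OF y that] by (simp_all add: F_def G_def P_def Q_def)
  let ?E = "{euler, \<theta>, \<eta>}"
  have "euler (?\<alpha> l) = ?\<alpha> l" for l
    by (simp only: derivation3_cone_normal[OF euler(1)] euler) (simp only: linear_form_cone_normal)
  then have E_sub: "?E \<subseteq> log_derivations B"
    using F P by (auto simp: D euler \<theta> \<eta> derivation3_cone_normal)
  have comb: "der_scale r euler + der_scale p \<theta> + der_scale q \<eta> \<in> der.span ?E" for r p q
    by (intro der.span_add der.span_scale der.span_base) auto
  have "\<psi> \<in> der.span ?E" if \<psi>: "\<psi> \<in> log_derivations B" for \<psi>
  proof -
    have \<psi>_der: "derivation3 \<psi>" using \<psi> by (simp add: D)
    obtain r where r: "\<psi> (var3 3) = var3 3 * r" using \<psi> by (auto simp: D elim: dvdE)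
    \<comment> \<open>Subtracting \<open>r\<close> times \<open>euler\<close> leaves a derivation
      that kills \<open>var3 3\<close>; \<open>f\<close> and \<open>g\<close> are its values at
      \<open>var3 1\<close> and \<open>shear_y\<close>.\<close>
    define f where "f = \<psi> (var3 1) - r * var3 1"
    define g where "g = \<psi> shear_y - r * shear_y"
    have fg: "?\<alpha> l dvd f - const3 (fst l) * g" if "l \<in> T" for l
    proof -
      have "f - const3 (fst l) * g = \<psi> (?\<alpha> l) - r * ?\<alpha> l"
        unfolding derivation3_cone_normal[OF \<psi>_der] r f_def g_def
        unfolding linear_form_cone_normal by (simp add: algebra_simps)
      moreover have "?\<alpha> l dvd \<psi> (?\<alpha> l) - r * ?\<alpha> l"
        using \<psi> that by (auto simp: D intro: dvd_diff)
      ultimately show ?thesis by simp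
    qed
    have "\<Delta> dvd f * G - g * F"
    proof (rule \<Delta>_dvd)
      fix l assume l: "l \<in> T"
      have "f * G - g * F = (f - const3 (fst l) * g) * G - g * (F - const3 (fst l) * G)"
        by (simp add: algebra_simps)
      then show "?\<alpha> l dvd f * G - g * F" using fg[OF l] F[OF l] by simp
    qed
    then obtain q where q: "f * G - g * F = \<Delta> * q" by (auto elim: dvdE)
    have "\<Delta> dvd P * g - Q * f"
    proof (rule \<Delta>_dvd)
      fix l assume l: "l \<in> T"
      have "P * g - Q * f = (P - const3 (fst l) * Q) * g - Q * (f - const3 (fst l) * g)"
        by (simp add: algebra_simps)
      then show "?\<alpha> l dvd P * g - Q * f" using fg[OF l] P[OF l] by simp
    qed
    then obtain p where p: "P * g - Q * f = \<Delta> * p" by (auto elim: dvdE)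
    \<comment> \<open>Cramer's rule: the quotients \<open>p\<close> and \<open>q\<close> are
      inserted, and the nonzero \<open>\<Delta>\<close> is cancelled.\<close>
    have "\<Delta> * f = (P * g - Q * f) * F + (f * G - g * F) * P"
      by (simp add: \<Delta>_def algebra_simps)
    then have "\<Delta> * f = \<Delta> * (p * F + q * P)" unfolding p q by (simp add: algebra_simps)
    then have f: "f = p * F + q * P" using \<Delta>_nz by simp
    have "\<Delta> * g = (P * g - Q * f) * G + (f * G - g * F) * Q"
      by (simp add: \<Delta>_def algebra_simps)
    then have "\<Delta> * g = \<Delta> * (p * G + q * Q)" unfolding p q by (simp add: algebra_simps)
    then have g: "g = p * G + q * Q" using \<Delta>_nz by simp
    have "\<psi> = der_scale r euler + der_scale p \<theta> + der_scale q \<eta>"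
    proof (rule derivation3_eqI_shear)
      have "der_scale r euler + der_scale p \<theta> + der_scale q \<eta> \<in> log_derivations B"
        using comb der.span_minimal[OF E_sub subspace_log_derivations] by blast
      then show "derivation3 (der_scale r euler + der_scale p \<theta> + der_scale q \<eta>)" by (simp add: D)
      show "derivation3 \<psi>" using \<psi> by (simp add: D)
      show "\<psi> (var3 1) = (der_scale r euler + der_scale p \<theta> + der_scale q \<eta>) (var3 1)"
        using f by (simp add: der_scale_def euler \<theta> \<eta> f_def algebra_simps)
      show "\<psi> shear_y = (der_scale r euler + der_scale p \<theta> + der_scale q \<eta>) shear_y"
        using g unfolding g_def der_scale_def plus_fun_def euler \<theta> \<eta> by (simp add: diff_eq_eq add_ac)
      show "\<psi> (var3 3) = (der_scale r euler + der_scale p \<theta> + der_scale q \<eta>) (var3 3)"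
        by (simp add: der_scale_def euler \<theta> \<eta> r mult.commute)
    qed
    then show ?thesis using comb by simp
  qed
  then have span: "der.span ?E = log_derivations B"
    using der.span_minimal[OF E_sub subspace_log_derivations] by blast
  have var3_nz: "var3 3 \<noteq> (0 :: 'a poly3)"
    unfolding Z[symmetric] by (simp add: linear_form_eq_0_iff axis_eq_0_iff)
  have zero: "r = 0 \<and> p = 0 \<and> q = 0"
    if sum: "der_scale r euler + der_scale p \<theta> + der_scale q \<eta> = 0" for r p q
  proof -
    have at: "r * euler v + p * \<theta> v + q * \<eta> v = 0" for v
      using fun_cong[OF sum, of v] by (simp add: der_scale_def)
    have r: "r = 0" using at[of "var3 3"] var3_nz by (simp add: euler \<theta> \<eta>)
    have 1: "p * F + q * P = 0" using at[of "var3 1"] r by (simp add: \<theta> \<eta>)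
    have 2: "p * G + q * Q = 0" using at[of shear_y] unfolding r \<theta> \<eta> by simp
    have "\<Delta> * p = (p * G + q * Q) * P - (p * F + q * P) * Q" by (simp add: \<Delta>_def algebra_simps)
    then have "p = 0" using 1 2 \<Delta>_nz by simp
    have "\<Delta> * q = (p * F + q * P) * G - (p * G + q * Q) * F" by (simp add: \<Delta>_def algebra_simps)
    then have "q = 0" using 1 2 \<Delta>_nz by simp
    then show ?thesis using r \<open>p = 0\<close> by simp
  qed
  \<comment> \<open>\<open>zero\<close> speaks of three coefficients, independence of a set; equal
    elements of \<open>?E\<close> would merge.\<close>
  have distinct: "euler \<noteq> \<theta>" "euler \<noteq> \<eta>" "\<theta> \<noteq> \<eta>"
    using zero[of 1 "-1" 0] zero[of 1 0 "-1"] zero[of 0 1 "-1"]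
    by (auto simp: der_scale_def fun_eq_iff)
  have "der.independent ?E"
    unfolding der.dependent_finite[OF finite.insertI[OF finite.insertI[OF finite.insertI[OF finite.emptyI]]]]
    using distinct zero by (auto simp: add.assoc)
  then show ?thesis unfolding free_arrangement_def B_def[symmetric] using E_sub span by blast
qed

end

section \<open>The characteristic polynomial\<close>

lemma excess_vimage:
  assumes "bij g"
  shows "excess (\<lambda>l. g -` J l) T = excess J T"
proof -
  have "bij_betw g {p. \<exists>k\<in>T. \<exists>l\<in>T. k \<noteq> l \<and> p \<in> g -` J k \<inter> g -` J l}
      {p. \<exists>k\<in>T. \<exists>l\<in>T. k \<noteq> l \<and> p \<in> J k \<inter> J l}"
    unfolding bij_betw_def
  proof
    show "g ` {p. \<exists>k\<in>T. \<exists>l\<in>T. k \<noteq> l \<and> p \<in> g -` J k \<inter> g -` J l} =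
      {p. \<exists>k\<in>T. \<exists>l\<in>T. k \<noteq> l \<and> p \<in> J k \<inter> J l}" (is "g ` ?X = ?Y")
    proof -
      have "?X = g -` ?Y" by auto
      then show ?thesis using bij_is_surj[OF assms] by (simp only: surj_image_vimage_eq)
    qed
  qed (rule inj_on_subset[OF bij_is_inj[OF assms] subset_UNIV])
  from sum.reindex_bij_betw[OF this, of "\<lambda>q. card {l \<in> T. q \<in> J l} - 1"]
  show ?thesis unfolding excess_def vimage_eq .
qed

lemma excess_image:
  assumes "inj_on I T"
  shows "excess id (I ` T) = excess I T"
proof -
  have "card {L \<in> I ` T. p \<in> id L} = card {l \<in> T. p \<in> I l}" for p
  proof -
    have "{L \<in> I ` T. p \<in> id L} = I ` {l \<in> T. p \<in> I l}" by auto
    then show ?thesis using assms by (simp add: card_image inj_on_subset)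
  qed
  moreover have "{p. \<exists>K\<in>I ` T. \<exists>L\<in>I ` T. K \<noteq> L \<and> p \<in> id K \<inter> id L} =
      {p. \<exists>k\<in>T. \<exists>l\<in>T. k \<noteq> l \<and> p \<in> I k \<inter> I l}"
    using inj_on_eq_iff[OF assms] by auto
  ultimately show ?thesis by (simp add: excess_def)
qed

section \<open>The lines in the original coordinates and their intersection poset\<close>

definition plane_line :: "'a::field \<Rightarrow> 'a \<times> 'a \<Rightarrow> ('a ^ 2) set" where
  "plane_line s l = {p. p $ 1 = fst l * (p $ 2 - s * p $ 1) + snd l}"

definition shear :: "'a::field \<Rightarrow> 'a ^ 2 \<Rightarrow> 'a \<times> 'a" where
  "shear s p = (p $ 1, p $ 2 - s * p $ 1)"

lemma bij_shear: "bij (shear s)"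
proof (rule bij_betw_byWitness[where f' = "\<lambda>q. vector [fst q, snd q + s * fst q]"])
  show "\<forall>p\<in>UNIV. vector [fst (shear s p), snd (shear s p) + s * fst (shear s p)] = p"
    by (simp add: shear_def vec_eq_iff forall_2)
qed (auto simp: shear_def)

lemma plane_line_vimage: "plane_line s l = shear s -` line_points l"
  by (simp add: plane_line_def line_points_def shear_def vimage_def)

lemma plane_line_Int:
  assumes "k \<noteq> l"
  shows "plane_line s k \<inter> plane_line s l = {} \<or> (\<exists>p. plane_line s k \<inter> plane_line s l = {p})"
proof -
  have "plane_line s k \<inter> plane_line s l = shear s -` (line_points k \<inter> line_points l)"
    by (simp add: plane_line_vimage)
  moreover have "\<exists>p. shear s -` {q} = {p}" for q
  proof -
    obtain p where "q = shear s p" using bij_is_surj[OF bij_shear] by (rule surjE)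
    then have "shear s -` {q} = {p}" by (auto simp: inj_eq[OF bij_is_inj[OF bij_shear]])
    then show ?thesis ..
  qed
  ultimately show ?thesis
    using line_points_Int[of l k] assms by (auto split: if_splits)
qed

lemma finite_plane_line_Int: "k \<noteq> l \<Longrightarrow> finite (plane_line s k \<inter> plane_line s l)"
  by (drule plane_line_Int[of _ _ s], elim disjE exE) simp_all

lemma plane_line_points:
  "vector [fst l * y + snd l, y + s * (fst l * y + snd l)] \<in> plane_line s l"
  by (simp add: plane_line_def)

lemma plane_line_not_subset_singleton: "\<not> plane_line s l \<subseteq> {p}"
proof
  assume "plane_line s l \<subseteq> {p}"
  then have "p = vector [fst l * y + snd l, y + s * (fst l * y + snd l)]" for y
    using plane_line_points[of l y s] by blast
  then have "p $ 2 - s * p $ 1 = y" for y by (metis add_diff_cancel_right' vector_2)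
  from this[of 0] this[of 1] show False by simp
qed

lemma plane_line_subset_iff: "plane_line s k \<subseteq> plane_line s l \<longleftrightarrow> k = l"
  using plane_line_Int[of k l s] plane_line_not_subset_singleton[of s k]
  by (metis Int_absorb2 empty_subsetI order_refl)

lemma inj_plane_line: "inj (plane_line s)"
  by (rule injI) (simp flip: plane_line_subset_iff[of s])

lemma plane_line_not_UNIV: "plane_line s l \<noteq> UNIV"
proof
  assume "plane_line s l = UNIV"
  then have "vector [snd l + 1, s * (snd l + 1)] \<in> plane_line s l" by simp
  then show False by (simp add: plane_line_def)
qed

lemma affine_dim_plane_line: "affine_dim (plane_line s l) = 1"
proof -
  \<comment> \<open>The direction of the line: the displacement when the sheared coordinate y grows
    by 1.\<close>
  define w :: "'a ^ 2" where "w = vector [fst l, 1 + s * fst l]"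
  have "w \<noteq> 0"
  proof
    assume "w = 0"
    then have "w $ 1 = 0" "w $ 2 = 0" by simp_all
    then show False by (simp add: w_def)
  qed
  have "{x - y | x y. x \<in> plane_line s l \<and> y \<in> plane_line s l} = range (\<lambda>c. c *s w)"
  proof safe
    fix x y assume xy: "x \<in> plane_line s l" "y \<in> plane_line s l"
    define a where "a = x $ 2 - s * x $ 1"
    define b where "b = y $ 2 - s * y $ 1"
    define c where "c = a - b"
    have "x $ 1 = fst l * a + snd l" "y $ 1 = fst l * b + snd l"
      using xy by (simp_all add: plane_line_def a_def b_def)
    then have 1: "x $ 1 - y $ 1 = fst l * c" by (simp add: c_def algebra_simps)
    have "x $ 2 - y $ 2 = c + s * (x $ 1 - y $ 1)" by (simp add: a_def b_def c_def algebra_simps)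
    then have "x - y = c *s w"
      using 1 by (simp add: vec_eq_iff forall_2 w_def algebra_simps)
    then show "x - y \<in> range (\<lambda>c. c *s w)" by blast
  next
    fix c
    have "c *s w = vector [fst l * c + snd l, c + s * (fst l * c + snd l)] - vector [fst l * 0 + snd l, 0 + s * (fst l * 0 + snd l)]"
      by (simp add: vec_eq_iff forall_2 w_def algebra_simps)
    then show "\<exists>x y. c *s w = x - y \<and> x \<in> plane_line s l \<and> y \<in> plane_line s l"
      using plane_line_points by blast
  qed
  also have "\<dots> = vec.span {w}" by (simp add: vec.span_singleton)
  finally show ?thesis
    unfolding affine_dim_def using \<open>w \<noteq> 0\<close> by simp
qed

lemma affine_dim_singleton: "affine_dim {p} = 0"
  by (simp add: affine_dim_def)

lemma affine_dim_UNIV: "affine_dim (UNIV :: ('a::field ^ 2) set) = 2"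
proof -
  have "{x - y | x y. x \<in> (UNIV :: ('a ^ 2) set) \<and> y \<in> UNIV} = UNIV"
  proof -
    have "x \<in> {x - y | x y. x \<in> (UNIV :: ('a ^ 2) set) \<and> y \<in> UNIV}" for x
      by (intro CollectI exI[of _ x] exI[of _ 0]) simp
    then show ?thesis by blast
  qed
  then show ?thesis
    unfolding affine_dim_def by (simp add: vec.dimension_def card_cart_basis)
qed

lemma intersection_poset_plane_lines:
  fixes s :: "'a::field"
  defines "P \<equiv> \<lambda>A. {p. \<exists>K\<in>A. \<exists>L\<in>A. K \<noteq> L \<and> p \<in> K \<inter> L}"
  shows "intersection_poset (plane_line s ` T) =
    insert UNIV (plane_line s ` T \<union> (\<lambda>p. {p}) ` P (plane_line s ` T))"
proof (rule set_eqI, rule iffI)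
  let ?A = "plane_line s ` T"
  fix X assume "X \<in> intersection_poset ?A"
  then obtain B where X: "X \<noteq> {}" "B \<subseteq> ?A" "X = \<Inter>B" by (auto simp: intersection_poset_def)
  consider "B = {}" | L where "B = {L}" | K L where "K \<in> B" "L \<in> B" "K \<noteq> L" by blast
  then show "X \<in> insert UNIV (?A \<union> (\<lambda>p. {p}) ` P ?A)"
  proof cases
    case 3
    then obtain k l where kl: "K = plane_line s k" "L = plane_line s l" using X by blast
    then have "k \<noteq> l" using 3 by blast
    moreover have "X \<subseteq> K \<inter> L" using 3 X by blast
    ultimately obtain p where p: "K \<inter> L = {p}" "X \<subseteq> {p}"
      using plane_line_Int[of k l s] X(1) kl by auto
    have "X = {p}" using p(2) X(1) by auto
    moreover have "K \<in> ?A" "L \<in> ?A" "p \<in> K \<inter> L" using X(2) 3 p(1) by auto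
    then have "p \<in> P ?A" using 3(3) unfolding P_def by blast
    ultimately show ?thesis by blast
  qed (use X in auto)
next
  let ?A = "plane_line s ` T"
  fix X assume "X \<in> insert UNIV (?A \<union> (\<lambda>p. {p}) ` P ?A)"
  then consider "X = UNIV" | l where "l \<in> T" "X = plane_line s l" | p where "p \<in> P ?A" "X = {p}" by blast
  then show "X \<in> intersection_poset ?A"
  proof cases
    case 1
    then show ?thesis unfolding intersection_poset_def by auto
  next
    case 2
    then have "X = \<Inter>{plane_line s l}" "{plane_line s l} \<subseteq> ?A" "X \<noteq> {}"
      using plane_line_points[of l 0 s] by auto
    then show ?thesis unfolding intersection_poset_def by blast
  next
    case 3
    then obtain K L where KL: "K \<in> ?A" "L \<in> ?A" "K \<noteq> L" "p \<in> K \<inter> L"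
      unfolding P_def by blast
    then obtain k l where kl: "K = plane_line s k" "L = plane_line s l" by blast
    then have "k \<noteq> l" using KL(3) by blast
    from plane_line_Int[OF this, of s] obtain q where q: "K \<inter> L = {q}"
      using KL(4) unfolding kl by (elim disjE exE) (blast, assumption)
    have "q = p" using KL(4) unfolding q by simp
    then have "X = \<Inter>{K, L}" using 3(2) q by simp
    moreover have "X \<noteq> {}" "{K, L} \<subseteq> ?A" using 3(2) KL(1,2) by simp_all
    ultimately show ?thesis unfolding intersection_poset_def by blast
  qed
qed

text \<open>The Moebius value is 1 at the plane, -1 at each line, and r - 1 at a point on r
  lines.\<close>

lemma char_polynomial_plane_lines:
  fixes s :: "'a::field"
  assumes fin: "finite T"
  shows "char_polynomial (plane_line s ` T) =
    monom 1 2 - monom (int (card T)) 1 + monom (int (excess line_points T)) 0"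
proof -
  let ?A = "plane_line s ` T"
  let ?P = "{p. \<exists>K\<in>?A. \<exists>L\<in>?A. K \<noteq> L \<and> p \<in> id K \<inter> id L}"
  let ?L = "intersection_poset ?A"
  let ?r = "\<lambda>p. card {L \<in> ?A. p \<in> L}"
  have L: "?L = insert UNIV (?A \<union> (\<lambda>p. {p}) ` ?P)"
    using intersection_poset_plane_lines[of s T] by simp
  have "?P \<subseteq> (\<Union>k\<in>T. \<Union>l\<in>T - {k}. plane_line s k \<inter> plane_line s l)" by auto
  moreover have "finite \<dots>"
    using fin by (intro finite_UN_I) (auto intro: finite_plane_line_Int)
  ultimately have finP: "finite ?P" by (rule finite_subset)
  have finL: "finite ?L" unfolding L using fin finP by simp
  have mUNIV: "moebius ?L UNIV = 1"
    using finL L by (subst moebius.simps) simp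
  have mline: "moebius ?L (plane_line s l) = - 1" if l: "l \<in> T" for l
  proof -
    have "{Y \<in> ?L. plane_line s l \<subset> Y} = {UNIV}"
      using plane_line_not_UNIV[of s l] plane_line_not_subset_singleton[of s l]
      unfolding L by (auto simp: plane_line_subset_iff psubset_eq)
    moreover have "plane_line s l \<in> ?L" using l by (simp add: L)
    ultimately show ?thesis
      using finL plane_line_not_UNIV[of s l] mUNIV by (subst moebius.simps) simp
  qed
  have mpoint: "moebius ?L {p} = int (?r p) - 1" if p: "p \<in> ?P" for p
  proof -
    have "{p} \<noteq> UNIV"
      using plane_line_not_subset_singleton[of s _ p] by blast
    \<comment> \<open>Above a point lie the plane and the r lines through it, with Moebius values
      summing to 1 - r.\<close>
    have up: "{Y \<in> ?L. {p} \<subset> Y} = insert UNIV {L \<in> ?A. p \<in> L}"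
      using plane_line_not_subset_singleton[of s _ p] \<open>{p} \<noteq> UNIV\<close> unfolding L by auto
    have "(\<Sum>Y\<in>{L \<in> ?A. p \<in> L}. moebius ?L Y) = (\<Sum>Y\<in>{L \<in> ?A. p \<in> L}. - 1)"
      by (rule sum.cong) (auto simp: mline)
    moreover have "UNIV \<notin> {L \<in> ?A. p \<in> L}" using plane_line_not_UNIV[of s] by (metis (no_types, lifting) imageE mem_Collect_eq)
    ultimately have "(\<Sum>Y\<in>{Y \<in> ?L. {p} \<subset> Y}. moebius ?L Y) = 1 - int (?r p)"
      unfolding up using fin mUNIV by simp
    moreover have "{p} \<in> ?L" using p by (simp only: L) blast
    ultimately show ?thesis
      using finL \<open>{p} \<noteq> UNIV\<close> by (subst moebius.simps) simp
  qed
  have "char_polynomial ?A = monom 1 2 + (\<Sum>X\<in>?A. monom (moebius ?L X) (affine_dim X))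
      + (\<Sum>X\<in>(\<lambda>p. {p}) ` ?P. monom (moebius ?L X) (affine_dim X))"
  proof -
    have "UNIV \<notin> ?A" using plane_line_not_UNIV[of s] by (metis imageE)
    moreover have disj: "?A \<inter> (\<lambda>p. {p}) ` ?P = {}"
      using plane_line_not_subset_singleton[of s] by (auto simp: disjoint_iff)
    moreover have "UNIV \<notin> (\<lambda>p. {p}) ` ?P"
    proof
      assume "UNIV \<in> (\<lambda>p. {p}) ` ?P"
      then obtain p :: "'a ^ 2" where "UNIV = {p}" by blast
      then show False using plane_line_not_subset_singleton[of s "(0, 0)" p] by auto
    qed
    ultimately have "char_polynomial ?A = monom (moebius ?L UNIV) (affine_dim (UNIV :: ('a ^ 2) set))
      + ((\<Sum>X\<in>?A. monom (moebius ?L X) (affine_dim X))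
      + (\<Sum>X\<in>(\<lambda>p. {p}) ` ?P. monom (moebius ?L X) (affine_dim X)))"
      unfolding char_polynomial_def using fin finP
      by (subst L, subst sum.insert) (auto intro!: sum.union_disjoint simp del: Int_iff)
    then show ?thesis by (simp add: mUNIV affine_dim_UNIV)
  qed
  also have "(\<Sum>X\<in>?A. monom (moebius ?L X) (affine_dim X)) = (\<Sum>X\<in>?A. monom (- 1) 1)"
    by (rule sum.cong) (auto simp: mline affine_dim_plane_line)
  also have "\<dots> = - monom (int (card T)) 1"
    using inj_on_subset[OF inj_plane_line[of s] subset_UNIV, of T]
    by (simp only: monom_sum[symmetric] sum_constant) (simp add: card_image minus_monom)
  also have "(\<Sum>X\<in>(\<lambda>p. {p}) ` ?P. monom (moebius ?L X) (affine_dim X)) = (\<Sum>p\<in>?P. monom (int (?r p) - 1) 0)"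
    by (subst sum.reindex) (auto simp: mpoint affine_dim_singleton intro!: sum.cong)
  also have "\<dots> = monom (int (excess id ?A)) 0"
  proof -
    have "int (?r p - 1) = int (?r p) - 1" if "p \<in> ?P" for p
    proof -
      have "?r p > 0" using that fin by (auto simp: card_gt_0_iff)
      then show ?thesis by simp
    qed
    then have "int (excess id ?A) = (\<Sum>p\<in>?P. int (?r p) - 1)"
      unfolding excess_def id_apply by (simp add: of_nat_sum)
    then show ?thesis by (simp add: monom_sum)
  qed
  also have "excess id ?A = excess line_points T"
  proof -
    have "plane_line s = (\<lambda>l. shear s -` line_points l)" by (intro ext plane_line_vimage)
    then have "excess (plane_line s) T = excess line_points T"
      using excess_vimage[OF bij_shear[of s], of line_points T] by simp
    then show ?thesis
      using excess_image[of "plane_line s" T] inj_on_subset[OF inj_plane_line[of s] subset_UNIV, of T] by simp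
  qed
  finally show ?thesis by simp
qed

lemma ex_shear:
  fixes A :: "('a::field_char_0 ^ 2) set set"
  assumes "affine_2_arrangement A"
  obtains s T where "finite T" "A = plane_line s ` T"
proof -
  have fin: "finite A" and "\<forall>L\<in>A. \<exists>a k. a \<noteq> 0 \<and> L = affine_line a k"
    using assms by (auto simp: affine_2_arrangement_def)
  then obtain a k where ak: "\<And>L. L \<in> A \<Longrightarrow> a L \<noteq> 0 \<and> L = affine_line (a L) (k L)" by metis
  \<comment> \<open>The excluded values are those for which x would drop out of a line's sheared
    equation. A line with \<open>a L $ 2 = 0\<close> has no such value; division by zero merely
    excludes 0 as well.\<close>
  obtain s where s: "s \<notin> (\<lambda>L. - (a L $ 1) / a L $ 2) ` A"
    using ex_new_if_finite[OF infinite_UNIV_char_0 finite_imageI[OF fin]] by blast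
  have "L \<in> range (plane_line s)" if "L \<in> A" for L
  proof
    let ?r = "a L $ 1 + a L $ 2 * s"
    have "?r \<noteq> 0"
    proof
      assume r: "?r = 0"
      then have "a L $ 2 \<noteq> 0" using ak[OF that] by (auto simp: vec_eq_iff forall_2)
      then have "s = - (a L $ 1) / a L $ 2" using r by (simp add: field_simps eq_neg_iff_add_eq_0)
      then show False using s that by blast
    qed
    have "x \<in> affine_line (a L) (k L) \<longleftrightarrow> x \<in> plane_line s (- (a L $ 2) / ?r, k L / ?r)" for x
    proof -
      have "x \<in> affine_line (a L) (k L) \<longleftrightarrow> ?r * x $ 1 = - (a L $ 2) * (x $ 2 - s * x $ 1) + k L"
        by (auto simp: affine_line_def scalar_product_def sum_2 algebra_simps)
      also have "\<dots> \<longleftrightarrow> x $ 1 = (- (a L $ 2) * (x $ 2 - s * x $ 1) + k L) / ?r"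
        using \<open>?r \<noteq> 0\<close> by (simp add: eq_divide_eq mult.commute)
      also have "\<dots> \<longleftrightarrow> x \<in> plane_line s (- (a L $ 2) / ?r, k L / ?r)"
        by (simp add: plane_line_def add_divide_distrib diff_divide_distrib)
      finally show ?thesis .
    qed
    then show "L = plane_line s (- (a L $ 2) / ?r, k L / ?r)" using ak[OF that] by blast
  qed simp
  then have "A = plane_line s ` (plane_line s -` A)" by auto
  moreover have "finite (plane_line s -` A)" using fin inj_plane_line by (rule finite_vimageI)
  ultimately show thesis using that by blast
qed

section \<open>Coning and Ziegler restriction\<close>

definition cone_hyperplane :: "'a::field \<Rightarrow> 'a \<times> 'a \<Rightarrow> ('a ^ 3) set" where
  "cone_hyperplane s l = {x. scalar_product (cone_normal s l) x = 0}"

lemma infinite_hyperplane_eq: "infinite_hyperplane = {x :: 'a::field ^ 3. scalar_product (axis 3 1) x = 0}"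
  by (simp add: infinite_hyperplane_def scalar_product_def sum_3 axis_def)

lemma plane_line_eq_affine_line:
  "plane_line s l = affine_line (vector [1 + fst l * s, - fst l]) (snd l)"
  by (auto simp: plane_line_def affine_line_def scalar_product_def sum_2 algebra_simps)

lemma cone_hyperplane_eq_cone_plane:
  "cone_hyperplane s l = cone_plane (vector [1 + fst l * s, - fst l]) (snd l)"
  by (simp add: cone_hyperplane_def cone_plane_def scalar_product_def sum_3 cone_normal_def)

text \<open>\<open>coning\<close> uses every equation of a line. Evaluation at the points of the
  line with sheared coordinate 0 and 1 shows that each equation is \<open>r\<close> times the normal
  form.\<close>

lemma cone_plane_eq_cone_hyperplane:
  assumes "a \<noteq> 0" "affine_line a k = plane_line s l"
  shows "cone_plane a k = cone_hyperplane s l"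
proof -
  define r where "r = a $ 1 + a $ 2 * s"
  have on: "a $ 1 * (fst l * y + snd l) + a $ 2 * (y + s * (fst l * y + snd l)) = k" for y
    using plane_line_points[of l y s]
    unfolding assms(2)[symmetric] by (simp add: affine_line_def scalar_product_def sum_2)
  have k: "k = r * snd l" using on[of 0] by (simp add: r_def algebra_simps)
  have "r * (fst l + snd l) + a $ 2 = k" using on[of 1] by (simp add: r_def algebra_simps)
  then have a2: "a $ 2 = r * - fst l" unfolding k by (simp add: algebra_simps eq_neg_iff_add_eq_0)
  have "a $ 1 = r - a $ 2 * s" by (simp add: r_def)
  then have a1: "a $ 1 = r * (1 + fst l * s)" unfolding a2 by (simp add: algebra_simps)
  have "r \<noteq> 0" using assms(1) a1 a2 by (auto simp: vec_eq_iff forall_2)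
  have "x \<in> cone_plane a k \<longleftrightarrow> x \<in> cone_hyperplane s l" for x
  proof -
    have "x \<in> cone_plane a k \<longleftrightarrow> r * ((1 + fst l * s) * x $ 1 - fst l * x $ 2) = r * (snd l * x $ 3)"
      by (simp add: cone_plane_def a1 a2 k algebra_simps)
    also have "\<dots> \<longleftrightarrow> x \<in> cone_hyperplane s l"
      using \<open>r \<noteq> 0\<close> by (simp add: cone_hyperplane_eq_cone_plane cone_plane_def)
    finally show ?thesis .
  qed
  then show ?thesis by blast
qed

lemma coning_plane_lines:
  "coning (plane_line s ` T) = insert infinite_hyperplane (cone_hyperplane s ` T)"
proof -
  have "vector [1 + fst l * s, - fst l] \<noteq> (0 :: 'a ^ 2)" for l :: "'a \<times> 'a"
    by (auto simp: vec_eq_iff forall_2)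
  then have "cone_hyperplane s l \<in> {cone_plane a k | a k. a \<noteq> 0 \<and> affine_line a k \<in> plane_line s ` T}"
    if "l \<in> T" for l
    using that cone_hyperplane_eq_cone_plane[of s l] plane_line_eq_affine_line[of s l] by blast
  then have "cone_hyperplane s ` T \<subseteq> {cone_plane a k | a k. a \<noteq> 0 \<and> affine_line a k \<in> plane_line s ` T}"
    by (rule image_subsetI)
  moreover have "{cone_plane a k | a k. a \<noteq> 0 \<and> affine_line a k \<in> plane_line s ` T} \<subseteq> cone_hyperplane s ` T"
    using cone_plane_eq_cone_hyperplane[of _ _ s] by blast
  ultimately show ?thesis unfolding coning_def by (intro arg_cong[where f = "insert _"] subset_antisym)
qed

lemma inj_cone_hyperplane: "inj (cone_hyperplane s)"
proof (rule injI)
  fix k l assume "cone_hyperplane s k = cone_hyperplane s l"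
  then obtain r where "cone_normal s k = r *s cone_normal s l"
    using hyperplane_eq_imp_scale[OF _ cone_normal_nz cone_normal_nz] unfolding cone_hyperplane_def by blast
  then show "k = l" by (rule cone_normal_parallel)
qed

lemma infinite_hyperplane_not_cone: "cone_hyperplane s l \<noteq> infinite_hyperplane"
proof
  assume "cone_hyperplane s l = infinite_hyperplane"
  then obtain r where "cone_normal s l = r *s axis 3 1"
    using hyperplane_eq_imp_scale[OF _ cone_normal_nz, of s l "axis 3 1"]
    unfolding cone_hyperplane_def infinite_hyperplane_eq by (auto simp: axis_eq_0_iff)
  then show False using cone_normal_not_infinite by blast
qed

text \<open>The line in the infinite hyperplane spanned by \<open>(t, 1 + t * s, 0)\<close>, the
  common direction of the affine lines of sheared slope \<open>t\<close>.\<close>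

definition direction :: "'a::field \<Rightarrow> 'a \<Rightarrow> ('a ^ 3) set" where
  "direction s t = {x. x $ 3 = 0 \<and> (1 + t * s) * x $ 1 = t * x $ 2}"

lemma inj_direction: "inj (direction s)"
proof (rule injI)
  fix t u assume "direction s t = direction s u"
  moreover have "vector [t, 1 + t * s, 0] \<in> direction s t" by (simp add: direction_def mult.commute)
  ultimately have "vector [t, 1 + t * s, 0] \<in> direction s u" by simp
  then show "t = u" by (simp add: direction_def algebra_simps)
qed

lemma cone_hyperplane_Int: "cone_hyperplane s l \<inter> infinite_hyperplane = direction s (fst l)"
  by (auto simp: cone_hyperplane_eq_cone_plane cone_plane_def infinite_hyperplane_def direction_def)

lemma ziegler_restriction_plane_lines:
  fixes s :: "'a::field" and T :: "('a \<times> 'a) set"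
  defines "B \<equiv> coning (plane_line s ` T)"
  shows "ziegler_arrangement B infinite_hyperplane = direction s ` fst ` T"
    and "ziegler_mult B infinite_hyperplane (direction s t) = multiplicity_at T t"
proof -
  have B: "B - {infinite_hyperplane} = cone_hyperplane s ` T"
    using infinite_hyperplane_not_cone by (auto simp: B_def coning_plane_lines)
  show "ziegler_arrangement B infinite_hyperplane = direction s ` fst ` T"
    unfolding ziegler_arrangement_def B image_image cone_hyperplane_Int ..
  have "{H \<in> cone_hyperplane s ` T. H \<inter> infinite_hyperplane = direction s t} = cone_hyperplane s ` {l \<in> T. fst l = t}"
    by (simp only: Compr_image_eq cone_hyperplane_Int inj_eq[OF inj_direction])
  then show "ziegler_mult B infinite_hyperplane (direction s t) = multiplicity_at T t"
    unfolding ziegler_mult_def B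
    using card_image[OF inj_on_subset[OF inj_cone_hyperplane[of s] subset_UNIV], of "{l \<in> T. fst l = t}"]
    by simp
qed

theorem theorem0p3:
  fixes Abar :: "('a::field_char_0 ^ 2) set set"
    and A :: "('a ^ 3) set set"
    and m :: "('a ^ 3) set \<Rightarrow> nat"
    and h :: nat
    and d :: int
  assumes "affine_2_arrangement Abar"
    and "(A, m) = ziegler_restriction (coning Abar) infinite_hyperplane"
    and "card A = h"
    and "h > 2"
    and "balanced A m"
    and "char_polynomial Abar = [:- d, 1:] * [:- (d + int h - 2), 1:] \<or>
         char_polynomial Abar = [:- d, 1:] * [:- (d + int h - 3), 1:]"
  shows "free_arrangement (coning Abar)"
proof -
  obtain s T where T: "finite T" "Abar = plane_line s ` T"
    using ex_shear[OF assms(1)] .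
  let ?S = "fst ` T" and ?n = "card T"
  have A: "A = direction s ` ?S" "m (direction s t) = multiplicity_at T t" for t
    using assms(2) ziegler_restriction_plane_lines[of s T] T(2) by (auto simp: ziegler_restriction_def)
  have inj: "inj_on (direction s) V" for V using inj_on_subset[OF inj_direction subset_UNIV] .
  have h: "card ?S = h" using assms(3) inj by (simp add: A(1) card_image)
  have sum: "(\<Sum>t\<in>?S. multiplicity_at T t) = ?n"
    using sum.image_gen[OF T(1), of "\<lambda>_. 1::nat" fst] by simp
  have bal: "multiplicity_at T t \<le> (\<Sum>u\<in>?S - {t}. multiplicity_at T u)" if "t \<in> ?S" for t
  proof -
    have "A - {direction s t} = direction s ` (?S - {t})"
      unfolding A(1) by (auto simp: inj_eq[OF inj_direction])
    then have "(\<Sum>H\<in>A - {direction s t}. m H) = (\<Sum>u\<in>?S - {t}. multiplicity_at T u)"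
      using inj by (simp add: sum.reindex A(2))
    moreover have "m (direction s t) \<le> (\<Sum>H\<in>A - {direction s t}. m H)"
      using assms(5) that by (auto simp: balanced_def A(1))
    ultimately show ?thesis by (simp add: A(2))
  qed
  obtain e y where y: "minimal_log_pair ?S (multiplicity_at T) e y" and "2 * e \<le> (\<Sum>t\<in>?S. multiplicity_at T t)"
    using ex_minimal_log_pair[of ?S "multiplicity_at T"] T(1) by blast
  then have e: "2 * e \<le> ?n" by (simp add: sum)
  have low: "?n + 2 \<le> 2 * e + h"
    using minimal_degree_bound[OF y bal] assms(4) h sum by simp
  have chi: "char_polynomial Abar = [:int (excess line_points T), - int ?n, 1:]"
    unfolding T(2) char_polynomial_plane_lines[OF T(1)] by (simp add: monom_Suc monom_0 numeral_eq_Suc)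
  \<comment> \<open>Comparing coefficients treats both polynomials at once: the roots
    \<open>d\<close> and \<open>d + h - i\<close> have sum \<open>n\<close> and product
    \<open>b\<close>.\<close>
  obtain i where i: "i = 2 \<or> i = 3" "int ?n = 2 * d + int h - i" "int (excess line_points T) = d * (d + int h - i)"
    using assms(6) unfolding chi by (auto simp: algebra_simps)
  have "int ?n - d = d + int h - i" using i(2) by simp
  then have coeffs: "int (excess line_points T) = d * (int ?n - d)" "2 * d \<le> int ?n - int h + 3"
    using i by (simp_all only: i(3), linarith)
  \<comment> \<open>The two bounds give 2 * d <= 2 * e + 1, and integrality removes the 1.\<close>
  have "d \<le> int e" using coeffs(2) low by linarith
  \<comment> \<open>This product equals e * (n - e) - d * (n - d).\<close>
  then have "0 \<le> (int e - d) * (int ?n - int e - d)" using e by (intro mult_nonneg_nonneg) linarith+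
  then have "int (excess line_points T) \<le> int e * (int ?n - int e)"
    unfolding coeffs(1) by (simp add: algebra_simps)
  also have "\<dots> = int (e * (?n - e))" using e by (simp add: of_nat_diff)
  finally have "excess line_points T \<le> e * (?n - e)" by (simp only: of_nat_le_iff)
  from ex_log_fields_basis[OF T(1) y e this] obtain x1 x2 a where x:
    "x1 \<in> log_fields T (Suc e)" "x2 \<in> log_fields T (Suc (?n - e))" "a \<noteq> 0"
    "pair_det x2 x1 = (\<Prod>l\<in>T. line_eq l) * [:[:a:]:]" .
  have "free_arrangement ((\<lambda>v. {x. scalar_product v x = 0}) ` insert (axis 3 1) (cone_normal s ` T))"
    using free_cone[OF T(1) x(1,2) _ x(4,3)] e by simp
  moreover have "(\<lambda>v. {x. scalar_product v x = 0}) ` insert (axis 3 1) (cone_normal s ` T) = coning Abar"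
    by (simp add: T(2) coning_plane_lines infinite_hyperplane_eq cone_hyperplane_def image_image)
  ultimately show ?thesis by simp
qed

end
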